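(* Let $K$ be a finite simplicial complex equipped with a Morse shelling, and let $W$ be any discrete vector field on $K$ compatible with this Morse shelling (i.e. with its Morse tiling). Then $W$ is the gradient vector field of a discrete self-indexing Morse function on $K$ whose critical points are in one-to-one correspondence with the critical tiles of the shelling, preserving the index.
   Context: Tiles. Let $\Delta_n$ be the closed standard $n$-simplex with facets $\sigma_1,\dots,\sigma_{n+1}$. For $n\ge0$, $0\le k\le n+1$, $T^n_k=\Delta_n\setminus(\sigma_1\cup\dots\cup\sigma_k)$ (for $n=0$ both $T^0_0$ and $T^0_1$ denote a point; $T^n_{n+1}$ is the open simplex; $T^{-1}_0=\emptyset$); subsets of simplices affinely isomorphic to $T^n_k$ are basic tiles of dimension $n$ and order $k$. For $0\le k\le l+1\le n$, $T^{n,l}_k=\Delta_n\setminus(\sigma_1\cup\dots\cup\sigma_k\cup\tau)$ with $\tau$ an $l$-dimensional face not contained in $\sigma_1\cup\dots\cup\sigma_k$ ($\tau=\emptyset$ if $l=-1$); so $T^{n,l}_k=T^n_k\setminus T^l_k$ where $T^l_k=\tau\setminus(\sigma_1\cup\dots\cup\sigma_k)$, and $T^{n,n-1}_k=T^n_{k+1}$. A Morse tile is a subset of a simplex affinely isomorphic to some $T^{n,l}_k$; its dimension is $n$; it is critical of index $k$ if $l=k-1$ (then denoted $C^n_k$), and regular otherwise. Morse shellings. A Morse tiling of a finite simplicial complex $K$ is a partition of $K$ by Morse tiles (subsets of simplices of $K$) such that for every $j\ge0$ the union of tiles of dimension greater than $j$ is a subcomplex. A Morse shelling of $K$ is a Morse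 tiling together with a filtration $\emptyset=K_0\subset K_1\subset\dots\subset K_N=K$ by subcomplexes which are unions of tiles, such that each $K_i\setminus K_{i-1}$ is a single tile. Discrete Morse theory. $K^{[p]}$ is the set of $p$-simplices of $K$; $\tau>\sigma$ means $\sigma$ is a face of $\tau$. A function $f:K\to\mathbb{R}$ on the set of simplices is a discrete Morse function iff for every $\sigma\in K^{[p]}$: $\#\{\tau\in K^{[p+1]}:\tau>\sigma,\ f(\tau)\le f(\sigma)\}\le1$ and $\#\{\nu\in K^{[p-1]}:\nu<\sigma,\ f(\nu)\ge f(\sigma)\}\le1$. A discrete vector field is a map $W:K\to K\cup\{0\}$ with $W(K^{[p]})\subset K^{[p+1]}\cup\{0\}$; $W(\sigma)=0$ or $\sigma$ is a face of $W(\sigma)$; $W(\sigma)=0$ if $\sigma\in\mathrm{Im}(W)$; and $\#\{v\in K^{[p-1]}:W(v)=\sigma\}\le1$ for all $\sigma\in K^{[p]}$. A critical point of $W$ is a simplex $\sigma$ with $W(\sigma)=0$ and $\sigma\notin\mathrm{Im}(W)$; its index is $\dim\sigma$. The gradient vector field $W_f$ of $f$ is: $W_f(\sigma)=\tau$ if $\tau>\sigma$ is a $(p+1)$-simplex with $f(\tau)\le f(\sigma)$ ($\sigma$ of dimension $p$), and $W_f(\sigma)=0$ if there is none. Critical points of $f$ are those of $W_f$; $f$ is self-indexing if $f(\sigma)=p$ for every critical $p$-simplex $\sigma$. These notions of vector field and critical point apply to tiles as well, replacing simplices by the open simplices contained in the tile. Compatible vector fields. Vector fields $W^n_k$ on $T^n_k$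 are defined recursively. For $n=0$, $W^0_k=0$. For $n>0$, $W^n_{n+1}=0$. For $k\le n$, choose an ordering $\sigma_{k+1},\dots,\sigma_{n+1}$ of the facets not removed; this yields the partition $T^n_k=T^{n-1}_k\sqcup\dots\sqcup T^{n-1}_n\sqcup T^n_{n+1}$ with $T^{n-1}_l=\sigma_{l+1}\setminus(\sigma_1\cup\dots\cup\sigma_l)$; then $W^n_k(T^{n-1}_n)=T^n_{n+1}$, $W^n_k(T^n_{n+1})=0$, and for $k\le l\le n-1$ the restriction of $W^n_k$ to $T^{n-1}_l$ is some vector field $W^{n-1}_l$. All fields obtained this way (for all choices) are denoted $W^n_k$. A discrete vector field on the Morse tile $C^n_k=T^n_k\setminus T^{k-1}_k$ is obtained by restricting any $W^n_k$ to the open simplices of $C^n_k$; a discrete vector field on a regular $T^{n,l}_k=T^n_k\setminus T^l_k$ is obtained by restricting any $W^n_k$ which preserves $T^l_k$ (maps open simplices of $T^l_k$ to open simplices of $T^l_k$ or $0$). A discrete vector field on a Morse tiled set is compatible with the tiling iff it preserves the tiles and its restriction to each tile is, via some affine isomorphism, one of these fields ($W^n_k$ on basic tiles $T^n_k$; the restriction of some $W^n_k$ to the open simplices of $C^n_k$ on critical tiles $C^n_k$; or the restriction to $T^{n,l}_k$ of some $W^n_k$ which preserves $T^l_k$ on regular tiles $T^{n,l}_k$). *)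

theory Defs
  imports "HOL-Analysis.Analysis"
begin

section \<open>Simplices and open simplices\<close>

text \<open>
  Complexes in the sense of \<^const>\<open>simplicial_complex\<close> are families of geometric simplices. They
  contain the empty simplex (of dimension -1), which is excluded from all notions of discrete Morse
  theory below. The open simplex of a simplex is its relative interior; it is always referred to
  through the closed simplex.
\<close>

definition faces :: "'a::euclidean_space set \<Rightarrow> 'a set set" where
  "faces S = {F. F face_of S}"

definition dim_simplices :: "'a::euclidean_space set set \<Rightarrow> int \<Rightarrow> 'a set set" where
  "dim_simplices K p = {\<sigma> \<in> K. 0 \<le> p \<and> p simplex \<sigma>}"

definition open_cells :: "'a::euclidean_space set set \<Rightarrow> 'a set \<Rightarrow> 'a set set" where
  "open_cells K X = {\<sigma> \<in> K. \<sigma> \<noteq> {} \<and> rel_interior \<sigma> \<subseteq> X}"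

definition subcomplex_space :: "'a::euclidean_space set set \<Rightarrow> 'a set \<Rightarrow> bool" where
  "subcomplex_space K X \<longleftrightarrow> (\<exists>L \<subseteq> K. simplicial_complex L \<and> X = \<Union>L)"

section \<open>Tiles\<close>

text \<open>
  The standard \<open>n\<close>-simplex is determined up to affine isomorphism by being the convex hull of an
  affinely independent set \<open>V\<close> of \<open>n + 1\<close> points, and its facets are in bijection with their opposite
  vertices. So a subset affinely isomorphic to \<open>T^n_k\<close> is given by \<open>V\<close> and the set \<open>R\<close> of the \<open>k\<close>
  vertices opposite to the removed facets. For \<open>n = 0\<close> the facet opposite to the only vertex is
  empty, so that \<open>T^0_1\<close> is a point.
\<close>

definition facet :: "'a::euclidean_space set \<Rightarrow> 'a \<Rightarrow> 'a set" where
  "facet V v = convex hull (V - {v})"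

definition basic_tile :: "'a::euclidean_space set \<Rightarrow> 'a set \<Rightarrow> 'a set" where
  "basic_tile V R = convex hull V - (\<Union>v\<in>R. facet V v)"

definition is_basic_datum :: "'a::euclidean_space set \<Rightarrow> 'a set \<Rightarrow> bool" where
  "is_basic_datum V R \<longleftrightarrow> \<not> affine_dependent V \<and> V \<noteq> {} \<and> R \<subseteq> V"

text \<open>
  \<open>T^{n,l}_k\<close>: here \<open>U\<close> is the vertex set of the face \<open>\<tau>\<close>, so \<open>n = card V - 1\<close>, \<open>l = card U - 1\<close>,
  \<open>k = card R\<close>, and the cardinality conditions are \<open>k \<le> l + 1 \<le> n\<close>.
\<close>

definition is_morse_datum :: "'a::euclidean_space set \<Rightarrow> 'a set \<Rightarrow> 'a set \<Rightarrow> bool" where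
  "is_morse_datum V R U \<longleftrightarrow>
     is_basic_datum V R \<and> U \<subseteq> V \<and> card R \<le> card U \<and> card U \<le> card V - 1 \<and>
     (U \<noteq> {} \<longrightarrow> \<not> convex hull U \<subseteq> (\<Union>v\<in>R. facet V v))"

definition removed_face :: "'a::euclidean_space set \<Rightarrow> 'a set \<Rightarrow> 'a set \<Rightarrow> 'a set" where
  "removed_face V R U = convex hull U - (\<Union>v\<in>R. facet V v)"

definition morse_tile_set :: "'a::euclidean_space set \<Rightarrow> 'a set \<Rightarrow> 'a set \<Rightarrow> 'a set" where
  "morse_tile_set V R U = convex hull V - ((\<Union>v\<in>R. facet V v) \<union> convex hull U)"

definition morse_tile :: "nat \<Rightarrow> int \<Rightarrow> nat \<Rightarrow> 'a::euclidean_space set \<Rightarrow> bool" where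
  "morse_tile n l k T \<longleftrightarrow>
     (\<exists>V R U. is_morse_datum V R U \<and> card V = n + 1 \<and> int (card U) = l + 1 \<and> card R = k \<and>
        T = morse_tile_set V R U)"

definition critical_tile :: "nat \<Rightarrow> 'a::euclidean_space set \<Rightarrow> bool" where
  "critical_tile k T \<longleftrightarrow> (\<exists>n. morse_tile n (int k - 1) k T)"

section \<open>Morse tilings and shellings\<close>

definition morse_tiling :: "'a::euclidean_space set set \<Rightarrow> 'a set set \<Rightarrow> bool" where
  "morse_tiling K TT \<longleftrightarrow>
     partition_on (\<Union>K) TT \<and>
     (\<forall>T\<in>TT. (\<exists>n l k. morse_tile n l k T) \<and> (\<exists>\<sigma>\<in>K. T \<subseteq> \<sigma>)) \<and>
     (\<forall>j::nat. subcomplex_space K (\<Union>{T \<in> TT. \<exists>n l k. morse_tile n l k T \<and> j < n}))"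

text \<open>The subcomplexes of the filtration are given by their underlying spaces.\<close>

definition morse_shelling ::
    "'a::euclidean_space set set \<Rightarrow> 'a set set \<Rightarrow> nat \<Rightarrow> (nat \<Rightarrow> 'a set) \<Rightarrow> bool" where
  "morse_shelling K TT N F \<longleftrightarrow>
     morse_tiling K TT \<and> F 0 = {} \<and> F N = \<Union>K \<and>
     (\<forall>i\<le>N. subcomplex_space K (F i) \<and> (\<exists>A \<subseteq> TT. F i = \<Union>A)) \<and>
     (\<forall>i\<in>{1..N}. F (i - 1) \<subseteq> F i \<and> F i - F (i - 1) \<in> TT)"

section \<open>Discrete Morse theory\<close>

definition discrete_morse_function ::
    "'a::euclidean_space set set \<Rightarrow> ('a set \<Rightarrow> real) \<Rightarrow> bool" where
  "discrete_morse_function K f \<longleftrightarrow>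
     (\<forall>p. \<forall>\<sigma>\<in>dim_simplices K p.
        card {\<tau> \<in> dim_simplices K (p + 1). \<sigma> face_of \<tau> \<and> f \<tau> \<le> f \<sigma>} \<le> 1 \<and>
        card {\<nu> \<in> dim_simplices K (p - 1). \<nu> face_of \<sigma> \<and> f \<nu> \<ge> f \<sigma>} \<le> 1)"

text \<open>
  The value \<open>0\<close> of a vector field is \<^const>\<open>None\<close>, and a vector field has this value outside
  its domain of definition.
\<close>

definition discrete_vector_field ::
    "'a::euclidean_space set set \<Rightarrow> ('a set \<rightharpoonup> 'a set) \<Rightarrow> bool" where
  "discrete_vector_field K W \<longleftrightarrow>
     dom W \<subseteq> K - {{}} \<and>
     (\<forall>p. \<forall>\<sigma>\<in>dim_simplices K p. \<forall>\<tau>. W \<sigma> = Some \<tau> \<longrightarrow> \<tau> \<in> dim_simplices K (p + 1)) \<and>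
     (\<forall>\<sigma> \<tau>. W \<sigma> = Some \<tau> \<longrightarrow> \<sigma> face_of \<tau>) \<and>
     (\<forall>\<sigma>\<in>ran W. W \<sigma> = None) \<and>
     (\<forall>p. \<forall>\<sigma>\<in>dim_simplices K p. card {\<nu> \<in> dim_simplices K (p - 1). W \<nu> = Some \<sigma>} \<le> 1)"

definition critical_points ::
    "'a::euclidean_space set set \<Rightarrow> ('a set \<rightharpoonup> 'a set) \<Rightarrow> 'a set set" where
  "critical_points K W = {\<sigma> \<in> K. \<sigma> \<noteq> {} \<and> W \<sigma> = None \<and> \<sigma> \<notin> ran W}"

definition gradient_field ::
    "'a::euclidean_space set set \<Rightarrow> ('a set \<Rightarrow> real) \<Rightarrow> ('a set \<rightharpoonup> 'a set)" where
  "gradient_field K f \<sigma> =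
     (let A = {\<tau>. \<exists>p. \<sigma> \<in> dim_simplices K p \<and> \<tau> \<in> dim_simplices K (p + 1) \<and>
                      \<sigma> face_of \<tau> \<and> f \<tau> \<le> f \<sigma>}
      in if A = {} then None else Some (SOME \<tau>. \<tau> \<in> A))"

definition self_indexing :: "'a::euclidean_space set set \<Rightarrow> ('a set \<Rightarrow> real) \<Rightarrow> bool" where
  "self_indexing K f \<longleftrightarrow>
     (\<forall>p. \<forall>\<sigma> \<in> critical_points K (gradient_field K f) \<inter> dim_simplices K p. f \<sigma> = real_of_int p)"

section \<open>Compatible vector fields\<close>

text \<open>
  \<open>basic_field V R W\<close>: the map \<open>W\<close> is one of the fields \<open>W^n_k\<close> on the tile \<open>basic_tile V R\<close>.
  The list \<open>vs\<close> is the chosen ordering of the facets not removed, each given by its opposite vertex: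
  in the partition of \<open>T^n_k\<close> the \<open>i\<close>-th piece is the facet of \<open>vs ! i\<close> deprived of the
  facets opposite to \<open>R\<close> and to \<open>vs ! 0, ..., vs ! (i - 1)\<close>, the last but one piece is the
  open simplex of the facet of \<open>last vs\<close>, and the last piece is the open simplex of \<open>V\<close>.
\<close>

inductive basic_field ::
    "'a::euclidean_space set \<Rightarrow> 'a set \<Rightarrow> ('a set \<rightharpoonup> 'a set) \<Rightarrow> bool" where
  point: "\<lbrakk>is_basic_datum V R; card V = 1\<rbrakk> \<Longrightarrow> basic_field V R Map.empty"
| open_simplex: "\<lbrakk>is_basic_datum V V; 2 \<le> card V\<rbrakk> \<Longrightarrow> basic_field V V Map.empty"
| step:
    "\<lbrakk>is_basic_datum V R; 2 \<le> card V; R \<noteq> V; distinct vs; set vs = V - R;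
      dom W \<subseteq> open_cells (faces (convex hull V)) (basic_tile V R);
      W (facet V (last vs)) = Some (convex hull V);
      W (convex hull V) = None;
      \<And>i. i < length vs - 1 \<Longrightarrow>
        basic_field (V - {vs ! i}) (R \<union> set (take i vs))
          (W |` open_cells (faces (facet V (vs ! i)))
                  (basic_tile (V - {vs ! i}) (R \<union> set (take i vs))))\<rbrakk>
     \<Longrightarrow> basic_field V R W"

definition preserves_cells :: "('a set \<rightharpoonup> 'a set) \<Rightarrow> 'a set set \<Rightarrow> bool" where
  "preserves_cells W C \<longleftrightarrow> (\<forall>\<sigma>\<in>C. \<forall>\<tau>. W \<sigma> = Some \<tau> \<longrightarrow> \<tau> \<in> C)"

definition field_on_basic_tile :: "'a::euclidean_space set \<Rightarrow> ('a set \<rightharpoonup> 'a set) \<Rightarrow> bool" where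
  "field_on_basic_tile T X \<longleftrightarrow>
     (\<exists>V R. is_basic_datum V R \<and> T = basic_tile V R \<and> basic_field V R X)"

definition field_on_critical_tile :: "'a::euclidean_space set \<Rightarrow> ('a set \<rightharpoonup> 'a set) \<Rightarrow> bool" where
  "field_on_critical_tile T X \<longleftrightarrow>
     (\<exists>V R U Y. is_morse_datum V R U \<and> card U = card R \<and> T = morse_tile_set V R U \<and>
        basic_field V R Y \<and> X = Y |` open_cells (faces (convex hull V)) T)"

definition field_on_regular_tile :: "'a::euclidean_space set \<Rightarrow> ('a set \<rightharpoonup> 'a set) \<Rightarrow> bool" where
  "field_on_regular_tile T X \<longleftrightarrow>
     (\<exists>V R U Y. is_morse_datum V R U \<and> card U \<noteq> card R \<and> T = morse_tile_set V R U \<and>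
        basic_field V R Y \<and>
        preserves_cells Y (open_cells (faces (convex hull V)) (removed_face V R U)) \<and>
        X = Y |` open_cells (faces (convex hull V)) T)"

definition compatible_field ::
    "'a::euclidean_space set set \<Rightarrow> 'a set set \<Rightarrow> ('a set \<rightharpoonup> 'a set) \<Rightarrow> bool" where
  "compatible_field K TT W \<longleftrightarrow>
     (\<forall>T\<in>TT. preserves_cells W (open_cells K T) \<and>
        (let X = W |` open_cells K T in
           field_on_basic_tile T X \<or> field_on_critical_tile T X \<or> field_on_regular_tile T X))"

end

theory Submission
  imports Defs
begin

text \<open>
  \<^bold>\<open>Reduction to acyclicity.\<close> A function \<open>f\<close> is a discrete Morse function with gradient field \<open>W\<close> as soon
  as, for every facet \<open>\<sigma>\<close> of a simplex \<open>\<tau>\<close>, the inequality \<open>f \<tau> \<le> f \<sigma>\<close> holds exactly when \<open>W\<close> maps \<open>\<sigma>\<close>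
  to \<open>\<tau>\<close>. Such a function with \<open>f \<sigma> = dim \<sigma>\<close> at critical simplices exists as soon as \<open>W\<close> has no
  closed gradient path: matched pairs get values between the two dimensions involved, ordered along
  gradient paths (\<open>acyclic_field_is_gradient\<close>).

  \<^bold>\<open>Acyclicity.\<close> A matching that preserves the levels of a filtration by subcomplexes is acyclic if it
  is so on each level, as gradient paths never climb in the filtration (\<open>acyclic_matching_glue\<close>).
  This argument is used twice: for the ordered facets of a simplex, by induction on the construction
  of the fields on basic tiles (\<open>basic_field_matching\<close>), and for the shelling itself
  (\<open>acyclic_matching_field\<close>).

  \<^bold>\<open>Critical points.\<close> The same induction shows that a field on a basic tile leaves at most one cell
  unmatched, a vertex if no facet is removed and the open simplex if all facets are removed. A Morse
  tile with \<open>R \<subseteq> U \<subset> V\<close> has \<open>2 ^ card (V - R) - 2 ^ card (U - R)\<close> open simplices. This number is odd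
  exactly when \<open>U = R\<close>, that is, for critical tiles. As matched cells come in pairs, regular tiles
  have no unmatched cell; on a critical tile with \<open>R \<noteq> {}\<close> the only unmatched cell is the former
  partner of the removed face, whose dimension is the index \<open>card R\<close>, and for \<open>R = {}\<close> it is
  the vertex left by the field on the basic tile (\<open>field_on_tile_matching\<close>). The
  parity also shows that being critical does not depend on the vertex data chosen for the tile.

  \<^bold>\<open>Tiles in the complex.\<close> These counts concern faces of the simplex spanned by the vertex data of a
  tile. They apply to \<open>K\<close> because in a shelling a tile is a difference of two subcomplexes, which
  forces this simplex to belong to \<open>K\<close> (\<open>open_cells_difference_tile\<close>).
\<close>

section \<open>Faces of the hull of an affinely independent set\<close>

text \<open>
  The vertices are extreme points of the whole simplex, hence of every face that contains them.
  Through this fact all incidences of faces reduce to inclusions of vertex sets.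
\<close>

lemma vertex_in_hull_iff:
  fixes V :: "'a::euclidean_space set"
  assumes "\<not> affine_dependent V" "G \<subseteq> V" "v \<in> V"
  shows "v \<in> convex hull G \<longleftrightarrow> v \<in> G"
proof
  assume v: "v \<in> convex hull G"
  have "v extreme_point_of (convex hull V)"
    using extreme_point_of_convex_hull_affine_independent[OF assms(1)] assms(3) by metis
  moreover have "convex hull G \<subseteq> convex hull V"
    using assms(2) by (rule hull_mono)
  ultimately have "v extreme_point_of (convex hull G)"
    using v unfolding extreme_point_of_def by (meson subsetD)
  then show "v \<in> G"
    by (rule extreme_point_of_convex_hull)
qed (rule hull_inc)

lemma hull_face_of_iff:
  fixes V :: "'a::euclidean_space set"
  assumes "\<not> affine_dependent V" "G \<subseteq> V" "H \<subseteq> V"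
  shows "convex hull G face_of convex hull H \<longleftrightarrow> G \<subseteq> H"
proof
  assume "convex hull G face_of convex hull H"
  then have "convex hull G \<subseteq> convex hull H"
    by (rule face_of_imp_subset)
  then show "G \<subseteq> H"
    using vertex_in_hull_iff[OF assms(1,3)] assms(2) hull_subset[of G convex] by blast
next
  assume "G \<subseteq> H"
  moreover have "\<not> affine_dependent H"
    using assms(1,3) by (rule affine_independent_subset)
  ultimately show "convex hull G face_of convex hull H"
    using face_of_convex_hull_affine_independent[of H "convex hull G"] by metis
qed

lemma hull_eq_iff:
  fixes V :: "'a::euclidean_space set"
  assumes "\<not> affine_dependent V" "G \<subseteq> V" "H \<subseteq> V"
  shows "convex hull G = convex hull H \<longleftrightarrow> G = H"
proof
  assume "convex hull G = convex hull H"
  then have "v \<in> G \<longleftrightarrow> v \<in> H" if "v \<in> V" for v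
    using vertex_in_hull_iff[OF assms(1,2) that] vertex_in_hull_iff[OF assms(1,3) that] by simp
  then show "G = H" using assms(2,3) by blast
qed simp

text \<open>
  A face of a simplex that meets the relative interior of a subset contains that subset.
\<close>

lemma rel_interior_hull_meets_hull_iff:
  fixes V :: "'a::euclidean_space set"
  assumes "\<not> affine_dependent V" "G \<subseteq> V" "H \<subseteq> V" "G \<noteq> {}"
  shows "rel_interior (convex hull G) \<inter> convex hull H \<noteq> {} \<longleftrightarrow> G \<subseteq> H"
proof
  assume m: "rel_interior (convex hull G) \<inter> convex hull H \<noteq> {}"
  have "convex hull H face_of convex hull V"
    using assms by (simp add: hull_face_of_iff)
  moreover have "convex hull G \<subseteq> convex hull V"
    using assms(2) by (rule hull_mono)
  ultimately have "convex hull G \<subseteq> convex hull H"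
    using m subset_of_face_of[of "convex hull H" "convex hull V" "convex hull G"]
    by (metis Int_commute)
  then show "G \<subseteq> H"
    using vertex_in_hull_iff[OF assms(1,3)] assms(2) hull_subset[of G convex] by blast
next
  assume "G \<subseteq> H"
  then have "rel_interior (convex hull G) \<subseteq> convex hull H"
    using hull_mono rel_interior_subset by blast
  then show "rel_interior (convex hull G) \<inter> convex hull H \<noteq> {}"
    using assms by (simp add: inf.absorb1 rel_interior_eq_empty)
qed

section \<open>Open simplices of tiles\<close>

text \<open>
  The combinatorial model of the tile with data \<open>V\<close>, \<open>R\<close>, \<open>U\<close>: an open face avoids the facet
  opposite to \<open>v\<close> if and only if \<open>v\<close> is one of its vertices, and it avoids the face spanned by \<open>U\<close>
  if and only if one of its vertices is not in \<open>U\<close>. The case \<open>U = {}\<close> gives basic tiles, as it only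
  excludes the empty face.
\<close>

definition hull_cells :: "'a::euclidean_space set \<Rightarrow> 'a set \<Rightarrow> 'a set \<Rightarrow> 'a set set" where
  "hull_cells V R U = (\<lambda>G. convex hull G) ` {G. R \<subseteq> G \<and> G \<subseteq> V \<and> \<not> G \<subseteq> U}"

lemma basic_tile_conv_morse_tile_set: "basic_tile V R = morse_tile_set V R {}"
  by (simp add: basic_tile_def morse_tile_set_def)

lemma rel_interior_subset_morse_tile_set_iff:
  fixes V :: "'a::euclidean_space set"
  assumes "\<not> affine_dependent V" "R \<subseteq> V" "U \<subseteq> V" "G \<subseteq> V" "G \<noteq> {}"
  shows "rel_interior (convex hull G) \<subseteq> morse_tile_set V R U \<longleftrightarrow> R \<subseteq> G \<and> \<not> G \<subseteq> U"
proof -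
  have "rel_interior (convex hull G) \<subseteq> convex hull V"
    using assms(4) hull_mono rel_interior_subset by blast
  then have "rel_interior (convex hull G) \<subseteq> morse_tile_set V R U \<longleftrightarrow>
      (\<forall>v\<in>R. rel_interior (convex hull G) \<inter> convex hull (V - {v}) = {}) \<and>
      rel_interior (convex hull G) \<inter> convex hull U = {}"
    unfolding morse_tile_set_def facet_def by blast
  also have "\<dots> \<longleftrightarrow> (\<forall>v\<in>R. \<not> G \<subseteq> V - {v}) \<and> \<not> G \<subseteq> U"
    using rel_interior_hull_meets_hull_iff[OF assms(1,4) _ assms(5)] assms(3) by (metis Diff_subset)
  also have "\<dots> \<longleftrightarrow> R \<subseteq> G \<and> \<not> G \<subseteq> U"
    using assms by blast
  finally show ?thesis .
qed

lemma faces_hull: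
  fixes V :: "'a::euclidean_space set"
  assumes "\<not> affine_dependent V"
  shows "faces (convex hull V) = (\<lambda>G. convex hull G) ` Pow V"
  using face_of_convex_hull_affine_independent[OF assms] by (auto simp: faces_def)

lemma open_cells_faces_hull:
  fixes V :: "'a::euclidean_space set"
  assumes "\<not> affine_dependent V"
  shows "open_cells (faces (convex hull V)) X =
    (\<lambda>G. convex hull G) ` {G. G \<subseteq> V \<and> G \<noteq> {} \<and> rel_interior (convex hull G) \<subseteq> X}"
  unfolding open_cells_def faces_hull[OF assms] by auto

lemma open_cells_morse_tile_set:
  fixes V :: "'a::euclidean_space set"
  assumes "\<not> affine_dependent V" "R \<subseteq> V" "U \<subseteq> V"
  shows "open_cells (faces (convex hull V)) (morse_tile_set V R U) = hull_cells V R U"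
proof -
  have "{G. G \<subseteq> V \<and> G \<noteq> {} \<and> rel_interior (convex hull G) \<subseteq> morse_tile_set V R U} =
      {G. R \<subseteq> G \<and> G \<subseteq> V \<and> \<not> G \<subseteq> U}"
    using rel_interior_subset_morse_tile_set_iff[OF assms] by blast
  then show ?thesis
    unfolding open_cells_faces_hull[OF assms(1)] hull_cells_def by simp
qed

lemma open_cells_basic_tile:
  assumes "is_basic_datum V R"
  shows "open_cells (faces (convex hull V)) (basic_tile V R) = hull_cells V R {}"
  using assms open_cells_morse_tile_set[of V R "{}"]
  by (simp add: is_basic_datum_def basic_tile_conv_morse_tile_set)

lemma open_cells_removed_face:
  fixes V :: "'a::euclidean_space set"
  assumes "\<not> affine_dependent V" "R \<subseteq> V" "U \<subseteq> V"
  shows "open_cells (faces (convex hull V)) (removed_face V R U) =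
         (\<lambda>G. convex hull G) ` {G. R \<subseteq> G \<and> G \<subseteq> U \<and> G \<noteq> {}}"
proof -
  have *: "rel_interior (convex hull G) \<subseteq> removed_face V R U \<longleftrightarrow> R \<subseteq> G \<and> G \<subseteq> U"
    if "G \<subseteq> V" "G \<noteq> {}" for G
  proof -
    have "rel_interior (convex hull G) \<noteq> {}"
      using that by (simp add: rel_interior_eq_empty)
    then have "rel_interior (convex hull G) \<subseteq> convex hull U \<longleftrightarrow> G \<subseteq> U"
      using rel_interior_hull_meets_hull_iff[OF assms(1) that(1) assms(3) that(2)]
        hull_mono[of G U convex] rel_interior_subset[of "convex hull G"] by blast
    moreover have "rel_interior (convex hull G) \<inter> convex hull (V - {v}) = {} \<longleftrightarrow> v \<in> G" if "v \<in> R" for v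
      using rel_interior_hull_meets_hull_iff[OF assms(1) \<open>G \<subseteq> V\<close> Diff_subset \<open>G \<noteq> {}\<close>, of "{v}"] \<open>G \<subseteq> V\<close>
      by blast
    moreover have "rel_interior (convex hull G) \<subseteq> removed_face V R U \<longleftrightarrow>
        rel_interior (convex hull G) \<subseteq> convex hull U \<and>
        (\<forall>v\<in>R. rel_interior (convex hull G) \<inter> convex hull (V - {v}) = {})"
      unfolding removed_face_def facet_def by blast
    ultimately show ?thesis by (auto simp: subset_iff)
  qed
  have "{G. G \<subseteq> V \<and> G \<noteq> {} \<and> rel_interior (convex hull G) \<subseteq> removed_face V R U} =
      {G. R \<subseteq> G \<and> G \<subseteq> U \<and> G \<noteq> {}}"
    using subset_trans[OF _ assms(3)] by (intro Collect_cong) (metis *)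
  then show ?thesis
    unfolding open_cells_faces_hull[OF assms(1)] by simp
qed

text \<open>
  If \<open>v \<in> R\<close> were not in \<open>U\<close>, the face spanned by \<open>U\<close> would lie in the facet opposite to \<open>v\<close>. For
  \<open>U = {}\<close>, the condition on cardinalities forces \<open>R = {}\<close>.
\<close>

lemma morse_datum_subset:
  assumes "is_morse_datum V R U"
  shows "R \<subseteq> U" "U \<subset> V"
proof -
  have V: "\<not> affine_dependent V" "V \<noteq> {}" "R \<subseteq> V" "U \<subseteq> V"
    and c: "card R \<le> card U" "card U \<le> card V - 1"
    and n: "U \<noteq> {} \<Longrightarrow> \<not> convex hull U \<subseteq> (\<Union>v\<in>R. facet V v)"
    using assms by (auto simp: is_morse_datum_def is_basic_datum_def)
  have "finite V" using V(1) aff_independent_finite by blast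
  then show "U \<subset> V"
    using V c by (metis One_nat_def Suc_pred card_gt_0_iff not_less_eq_eq order_refl psubsetI)
  show "R \<subseteq> U"
  proof (cases "U = {}")
    case True
    then show ?thesis using c(1) V(3) \<open>finite V\<close> finite_subset by fastforce
  next
    case False
    show ?thesis
    proof
      fix v assume "v \<in> R"
      show "v \<in> U"
      proof (rule ccontr)
        assume "v \<notin> U"
        then have "convex hull U \<subseteq> facet V v"
          unfolding facet_def using V(4) by (intro hull_mono) blast
        then show False using n False \<open>v \<in> R\<close> by blast
      qed
    qed
  qed
qed

lemma card_supersets:
  assumes "finite V" "R \<subseteq> V"
  shows "card {G. R \<subseteq> G \<and> G \<subseteq> V} = 2 ^ card (V - R)"
proof -
  have "{G. R \<subseteq> G \<and> G \<subseteq> V} = (\<lambda>H. R \<union> H) ` Pow (V - R)"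
  proof
    show "{G. R \<subseteq> G \<and> G \<subseteq> V} \<subseteq> (\<lambda>H. R \<union> H) ` Pow (V - R)"
    proof
      fix G assume "G \<in> {G. R \<subseteq> G \<and> G \<subseteq> V}"
      then have "G = R \<union> (G - R)" "G - R \<in> Pow (V - R)" by auto
      then show "G \<in> (\<lambda>H. R \<union> H) ` Pow (V - R)" by blast
    qed
  qed (use assms in auto)
  moreover have "inj_on (\<lambda>H. R \<union> H) (Pow (V - R))"
    by (intro inj_onI) blast
  ultimately show ?thesis
    using assms(1) by (simp add: card_image card_Pow)
qed

text \<open>
  The parity of this number detects critical tiles: for \<open>R \<subseteq> U \<subset> V\<close> it is odd if and only if
  \<open>U = R\<close>.
\<close>

lemma card_hull_cells:
  fixes V :: "'a::euclidean_space set"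
  assumes "\<not> affine_dependent V" "R \<subseteq> V" "U \<subseteq> V"
  shows "card (hull_cells V R U) =
    2 ^ card (V - R) - (if R \<subseteq> U then 2 ^ card (U - R) else 0)"
proof -
  have fin: "finite V" "finite U"
    using assms aff_independent_finite finite_subset by blast+
  have inj: "inj_on (\<lambda>G. convex hull G) {G. R \<subseteq> G \<and> G \<subseteq> V \<and> \<not> G \<subseteq> U}"
    using hull_eq_iff[OF assms(1)] by (intro inj_onI) blast
  have eq: "{G. R \<subseteq> G \<and> G \<subseteq> V \<and> \<not> G \<subseteq> U} = {G. R \<subseteq> G \<and> G \<subseteq> V} - {G. R \<subseteq> G \<and> G \<subseteq> U}"
    by blast
  have "card (hull_cells V R U) = card {G. R \<subseteq> G \<and> G \<subseteq> V} - card {G. R \<subseteq> G \<and> G \<subseteq> U}"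
    unfolding hull_cells_def card_image[OF inj] unfolding eq
  proof (rule card_Diff_subset)
    show "finite {G. R \<subseteq> G \<and> G \<subseteq> U}"
      by (rule finite_subset[of _ "Pow U"]) (use fin in auto)
  qed (use assms(3) in auto)
  moreover have "card {G. R \<subseteq> G \<and> G \<subseteq> U} = (if R \<subseteq> U then 2 ^ card (U - R) else 0)"
  proof (cases "R \<subseteq> U")
    case False
    then have "{G. R \<subseteq> G \<and> G \<subseteq> U} = {}" by blast
    then show ?thesis using False by (simp only: if_False card.empty)
  qed (simp add: card_supersets[OF fin(2)])
  ultimately show ?thesis
    using card_supersets[OF fin(1) assms(2)] by simp
qed

lemma finite_hull_cells:
  fixes V :: "'a::euclidean_space set"
  assumes "\<not> affine_dependent V"
  shows "finite (hull_cells V R U)"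
proof -
  have "{G. R \<subseteq> G \<and> G \<subseteq> V \<and> \<not> G \<subseteq> U} \<subseteq> Pow V" by blast
  then show ?thesis
    unfolding hull_cells_def using aff_independent_finite[OF assms]
    by (intro finite_imageI) (simp add: finite_subset)
qed

section \<open>Acyclic matchings\<close>

text \<open>
  The gradient paths of \<open>W\<close> run from \<open>\<nu>\<close> through \<open>W \<nu>\<close> to another face \<open>\<sigma>\<close> of \<open>W \<nu>\<close> at which \<open>W\<close> is
  defined. Faces of codimension larger than one are allowed as well: this creates no new cycles, as
  the dimension never increases along a path, and it avoids any mention of dimensions.
\<close>

definition flow :: "('a::euclidean_space set \<rightharpoonup> 'a set) \<Rightarrow> ('a set \<times> 'a set) set" where
  "flow W = {(\<sigma>, \<nu>). \<sigma> \<in> dom W \<and> \<sigma> \<noteq> \<nu> \<and> (\<exists>\<tau>. W \<nu> = Some \<tau> \<and> \<sigma> face_of \<tau>)}"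

definition acyclic_matching ::
    "'a::euclidean_space set set \<Rightarrow> ('a set \<rightharpoonup> 'a set) \<Rightarrow> bool" where
  "acyclic_matching C W \<longleftrightarrow>
     dom W \<subseteq> C \<and> ran W \<subseteq> C \<and> dom W \<inter> ran W = {} \<and> inj_on W (dom W) \<and> wf (flow W)"

definition unmatched ::
    "'a::euclidean_space set set \<Rightarrow> ('a set \<rightharpoonup> 'a set) \<Rightarrow> 'a set set" where
  "unmatched C W = C - dom W - ran W"

lemma acyclic_matching_empty: "acyclic_matching C Map.empty"
  by (auto simp: acyclic_matching_def flow_def)

lemma flow_restrict_subset: "flow (W |` D) \<subseteq> flow W"
  by (auto simp: flow_def restrict_map_def split: if_splits)

lemma acyclic_matching_restrict:
  assumes "acyclic_matching C W" "preserves_cells W D"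
  shows "acyclic_matching D (W |` D)"
proof -
  have "ran (W |` D) \<subseteq> D \<inter> ran W"
    using assms(2) by (auto simp: preserves_cells_def ran_def restrict_map_def split: if_splits)
  moreover have "inj_on (W |` D) (dom (W |` D))"
    using assms(1) by (auto simp: acyclic_matching_def inj_on_def restrict_map_def dom_def split: if_splits)
  ultimately show ?thesis
    using assms(1) wf_subset[OF _ flow_restrict_subset] by (auto simp: acyclic_matching_def)
qed

text \<open>
  Matched cells come in disjoint pairs.
\<close>

lemma even_card_iff_even_unmatched:
  assumes "finite C" "acyclic_matching C W"
  shows "even (card C) \<longleftrightarrow> even (card (unmatched C W))"
proof -
  have m: "dom W \<subseteq> C" "ran W \<subseteq> C" "dom W \<inter> ran W = {}" "inj_on W (dom W)"
    using assms by (auto simp: acyclic_matching_def)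
  have "inj_on (the \<circ> W) (dom W)"
  proof (rule inj_onI)
    fix \<sigma> \<nu> assume a: "\<sigma> \<in> dom W" "\<nu> \<in> dom W" "(the \<circ> W) \<sigma> = (the \<circ> W) \<nu>"
    then have "W \<sigma> = W \<nu>" by auto
    then show "\<sigma> = \<nu>" using m(4) a(1,2) by (simp add: inj_on_eq_iff)
  qed
  moreover have "(the \<circ> W) ` dom W = ran W"
    by (force simp: ran_def)
  ultimately have "card (ran W) = card (dom W)"
    using card_image by fastforce
  moreover have "finite (dom W)" "finite (ran W)"
    using m(1,2) assms(1) finite_subset by blast+
  then have "card (dom W \<union> ran W) = card (dom W) + card (ran W)"
    using m(3) by (simp add: card_Un_disjoint)
  moreover have "card (unmatched C W) + card (dom W \<union> ran W) = card C"
  proof -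
    have "unmatched C W = C - (dom W \<union> ran W)"
      unfolding unmatched_def by blast
    moreover have "dom W \<union> ran W \<subseteq> C" using m(1,2) by blast
    ultimately show ?thesis
      using assms(1) by (metis card_mono card_Diff_subset finite_subset le_add_diff_inverse2)
  qed
  ultimately have "card C = card (unmatched C W) + 2 * card (dom W)" by linarith
  then show ?thesis by simp
qed

text \<open>
  Among the elements of lowest level of a nonempty set, a minimal one within its level is minimal.
\<close>

lemma wf_if_wf_on_levels:
  fixes f :: "'b \<Rightarrow> nat"
  assumes mono: "\<And>x y. (x, y) \<in> r \<Longrightarrow> f x \<le> f y"
    and layer: "\<And>i. wf {(x, y) \<in> r. f x = i \<and> f y = i}"
  shows "wf r"
proof (rule wfI_min)
  fix x :: 'b and Q assume "x \<in> Q"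
  define i where "i = (LEAST i. i \<in> f ` Q)"
  have "i \<in> f ` Q"
    unfolding i_def by (rule LeastI[of _ "f x"]) (use \<open>x \<in> Q\<close> in simp)
  then obtain y where y: "y \<in> {z \<in> Q. f z = i}" by blast
  have "\<exists>z\<in>Q'. \<forall>w. (w, z) \<in> r' \<longrightarrow> w \<notin> Q'" if "wf r'" "y \<in> Q'" for r' Q'
    using that unfolding wf_eq_minimal by metis
  from this[OF layer[of i] y]
  obtain z where z: "z \<in> Q" "f z = i"
      and min: "\<And>w. (w, z) \<in> r \<Longrightarrow> f w = i \<Longrightarrow> w \<notin> Q"
    by blast
  have "w \<notin> Q" if "(w, z) \<in> r" for w
  proof
    assume "w \<in> Q"
    then have "i \<le> f w" unfolding i_def by (intro Least_le) blast
    then have "f w = i" using mono[OF that] z(2) by simp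
    then show False using min that z \<open>w \<in> Q\<close> by blast
  qed
  then show "\<exists>z\<in>Q. \<forall>y. (y, z) \<in> r \<longrightarrow> y \<notin> Q" using z(1) by blast
qed

text \<open>
  The gluing principle, used for the facets inside a simplex as well as for the tiles of a shelling.
  A rank that is monotone along faces filters \<open>C\<close> by subcomplexes. If \<open>W\<close> matches cells of equal
  rank only, no gradient path ever climbs in this filtration, so that a closed one would stay inside
  a level.
\<close>

lemma
  fixes C :: "'a::euclidean_space set set" and rank :: "'a set \<Rightarrow> nat"
  assumes dom: "dom W \<subseteq> C"
    and layer: "\<And>i. acyclic_matching {\<sigma> \<in> C. rank \<sigma> = i} (W |` {\<sigma> \<in> C. rank \<sigma> = i})"
    and mono: "\<And>\<sigma> \<tau>. \<sigma> \<in> C \<Longrightarrow> \<tau> \<in> C \<Longrightarrow> \<sigma> face_of \<tau> \<Longrightarrow> rank \<sigma> \<le> rank \<tau>"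
  shows acyclic_matching_glue: "acyclic_matching C W"
    and unmatched_glue:
      "unmatched C W = (\<Union>i. unmatched {\<sigma> \<in> C. rank \<sigma> = i} (W |` {\<sigma> \<in> C. rank \<sigma> = i}))"
proof -
  let ?P = "\<lambda>i. {\<sigma> \<in> C. rank \<sigma> = i}"
  have same: "\<tau> \<in> C \<and> \<sigma> \<in> C \<and> rank \<tau> = rank \<sigma>" if "W \<sigma> = Some \<tau>" for \<sigma> \<tau>
  proof -
    have "\<sigma> \<in> C" using that dom by blast
    then have "\<tau> \<in> ran (W |` ?P (rank \<sigma>))"
      using that by (auto simp: ran_def restrict_map_def)
    then show ?thesis using layer[of "rank \<sigma>"] \<open>\<sigma> \<in> C\<close> by (auto simp: acyclic_matching_def)
  qed
  have ran_iff: "\<tau> \<in> ran W \<longleftrightarrow> \<tau> \<in> ran (W |` ?P (rank \<tau>))" for \<tau>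
  proof -
    have "W \<sigma> = Some \<tau> \<longleftrightarrow> (W |` ?P (rank \<tau>)) \<sigma> = Some \<tau>" for \<sigma>
      using same[of \<sigma> \<tau>] by (auto simp: restrict_map_def)
    then show ?thesis by (simp add: ran_def)
  qed
  have ran: "ran W \<subseteq> C" using same by (auto simp: ran_def)
  have "dom W \<inter> ran W = {}"
  proof (rule ccontr)
    assume "dom W \<inter> ran W \<noteq> {}"
    then obtain \<sigma> where \<sigma>: "\<sigma> \<in> dom W" "\<sigma> \<in> ran (W |` ?P (rank \<sigma>))"
      using ran_iff by blast
    then have "\<sigma> \<in> dom (W |` ?P (rank \<sigma>))" using dom by auto
    then show False
      using layer[of "rank \<sigma>"] \<sigma>(2) unfolding acyclic_matching_def by blast
  qed
  moreover have "inj_on W (dom W)"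
  proof (rule inj_onI)
    fix \<sigma> \<nu> assume a: "\<sigma> \<in> dom W" "\<nu> \<in> dom W" "W \<sigma> = W \<nu>"
    then obtain \<tau> where "W \<sigma> = Some \<tau>" "W \<nu> = Some \<tau>" by auto
    then have "rank \<sigma> = rank \<nu>" "\<sigma> \<in> C" "\<nu> \<in> C" using same by metis+
    then have "(W |` ?P (rank \<nu>)) \<sigma> = (W |` ?P (rank \<nu>)) \<nu>"
        "\<sigma> \<in> dom (W |` ?P (rank \<nu>))" "\<nu> \<in> dom (W |` ?P (rank \<nu>))"
      using a by auto
    moreover have "inj_on (W |` ?P (rank \<nu>)) (dom (W |` ?P (rank \<nu>)))"
      using layer by (simp add: acyclic_matching_def)
    ultimately show "\<sigma> = \<nu>"
      by (meson inj_onD)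
  qed
  moreover have "wf (flow W)"
  proof (rule wf_if_wf_on_levels[where f = rank])
    show "rank \<sigma> \<le> rank \<nu>" if fl: "(\<sigma>, \<nu>) \<in> flow W" for \<sigma> \<nu>
    proof -
      obtain \<tau> where "\<sigma> \<in> dom W" "W \<nu> = Some \<tau>" "\<sigma> face_of \<tau>"
        using fl unfolding flow_def by blast
      then show ?thesis using same[of \<nu> \<tau>] mono[of \<sigma> \<tau>] dom by auto
    qed
    show "wf {(\<sigma>, \<nu>) \<in> flow W. rank \<sigma> = i \<and> rank \<nu> = i}" for i
    proof (rule wf_subset)
      show "wf (flow (W |` ?P i))" using layer by (simp add: acyclic_matching_def)
      show "{(\<sigma>, \<nu>) \<in> flow W. rank \<sigma> = i \<and> rank \<nu> = i} \<subseteq> flow (W |` ?P i)"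
        using same by (auto simp: flow_def restrict_map_def dom_def split: if_splits)
    qed
  qed
  ultimately show "acyclic_matching C W" using dom ran by (simp add: acyclic_matching_def)
  show "unmatched C W = (\<Union>i. unmatched (?P i) (W |` ?P i))"
  proof (rule set_eqI)
    fix \<tau>
    show "\<tau> \<in> unmatched C W \<longleftrightarrow> \<tau> \<in> (\<Union>i. unmatched (?P i) (W |` ?P i))"
      using ran_iff[of \<tau>] by (auto simp: unmatched_def)
  qed
qed

section \<open>Basic fields\<close>

text \<open>
  The situation of the recursive step in \<^const>\<open>basic_field\<close>: a tile with an ordering of the facets
  that it contains.
\<close>

locale facet_ordering =
  fixes V R :: "'a::euclidean_space set" and vs :: "'a list"
  assumes datum: "is_basic_datum V R" and card_V: "2 \<le> card V" and R_ne: "R \<noteq> V"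
    and dist: "distinct vs" and set_vs: "set vs = V - R"
begin

text \<open>
  The index of the piece that contains an open face of the tile. A face lies in the \<open>i\<close>-th piece if
  \<open>vs ! i\<close> is the first of its missing vertices. The value is bounded by \<open>length vs - 1\<close>, so that the
  open facet opposite to \<open>last vs\<close> and the open simplex, which are matched with each other, share the
  last piece.
\<close>

definition first_facet :: "'a set \<Rightarrow> nat" where
  "first_facet \<sigma> = (LEAST i. vs ! i \<notin> \<sigma> \<or> i = length vs - 1)"

lemma indep: "\<not> affine_dependent V" and fin: "finite V" and R_sub: "R \<subseteq> V"
  using datum aff_independent_finite by (auto simp: is_basic_datum_def)

lemma vs_ne: "vs \<noteq> []"
  using set_vs R_ne R_sub by auto

lemma first_facet_le: "first_facet \<sigma> \<le> length vs - 1"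
  unfolding first_facet_def by (intro Least_le) simp

lemma first_facet_mono: "\<sigma> \<subseteq> \<tau> \<Longrightarrow> first_facet \<sigma> \<le> first_facet \<tau>"
proof -
  assume s: "\<sigma> \<subseteq> \<tau>"
  have "vs ! first_facet \<tau> \<notin> \<tau> \<or> first_facet \<tau> = length vs - 1"
    unfolding first_facet_def by (rule LeastI[of _ "length vs - 1"]) simp
  then show ?thesis
    using s unfolding first_facet_def[of \<sigma>] by (intro Least_le) blast
qed

lemma first_facet_eq_iff:
  "i < length vs - 1 \<Longrightarrow> first_facet \<sigma> = i \<longleftrightarrow> vs ! i \<notin> \<sigma> \<and> set (take i vs) \<subseteq> \<sigma>"
proof -
  assume i: "i < length vs - 1"
  have "first_facet \<sigma> = i \<longleftrightarrow> vs ! i \<notin> \<sigma> \<and> (\<forall>j<i. vs ! j \<in> \<sigma>)"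
  proof
    assume f: "first_facet \<sigma> = i"
    have "vs ! first_facet \<sigma> \<notin> \<sigma> \<or> first_facet \<sigma> = length vs - 1"
      unfolding first_facet_def by (rule LeastI[of _ "length vs - 1"]) simp
    moreover have "vs ! j \<in> \<sigma>" if "j < i" for j
      using not_less_Least[of j "\<lambda>i. vs ! i \<notin> \<sigma> \<or> i = length vs - 1"] that f
      unfolding first_facet_def by blast
    ultimately show "vs ! i \<notin> \<sigma> \<and> (\<forall>j<i. vs ! j \<in> \<sigma>)" using f i by auto
  next
    assume a: "vs ! i \<notin> \<sigma> \<and> (\<forall>j<i. vs ! j \<in> \<sigma>)"
    show "first_facet \<sigma> = i"
      unfolding first_facet_def
    proof (rule Least_equality)
      show "i \<le> j" if "vs ! j \<notin> \<sigma> \<or> j = length vs - 1" for j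
        using a that i by (cases "j < i") auto
    qed (use a in blast)
  qed
  also have "(\<forall>j<i. vs ! j \<in> \<sigma>) \<longleftrightarrow> set (take i vs) \<subseteq> \<sigma>"
    using i nth_image[of i vs] by (metis atLeast0LessThan image_subset_iff lessThan_iff
        less_imp_le less_le_trans diff_le_self)
  finally show ?thesis .
qed

text \<open>
  The vertex \<open>vs ! Suc i\<close> is still available in the \<open>i\<close>-th piece. So the pieces treated recursively
  keep at least one facet, and none of them is an open simplex with an unmatched top cell.
\<close>

lemma piece_datum:
  assumes "i < length vs - 1"
  shows "is_basic_datum (V - {vs ! i}) (R \<union> set (take i vs))"
    and "R \<union> set (take i vs) \<noteq> V - {vs ! i}"
proof -
  have i: "i < length vs" "Suc i < length vs" using assms by auto
  then have v: "vs ! i \<in> V - R" "vs ! Suc i \<in> V - R"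
    using set_vs nth_mem by blast+
  have nt: "vs ! j \<notin> set (take i vs)" if "i \<le> j" "j < length vs" for j
    using that by (auto simp: in_set_conv_nth nth_eq_iff_index_eq[OF dist])
  have "vs ! Suc i \<noteq> vs ! i" using i dist by (simp add: nth_eq_iff_index_eq)
  then have m: "vs ! Suc i \<in> V - {vs ! i}" "vs ! Suc i \<notin> R \<union> set (take i vs)"
    using v nt[of "Suc i"] i by auto
  then show "R \<union> set (take i vs) \<noteq> V - {vs ! i}" by blast
  have "set (take i vs) \<subseteq> V" using set_take_subset set_vs by fastforce
  then show "is_basic_datum (V - {vs ! i}) (R \<union> set (take i vs))"
    unfolding is_basic_datum_def
    using m v R_sub nt[of i] i affine_independent_subset[OF indep, of "V - {vs ! i}"] by blast
qed

lemma piece_eq: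
  assumes "i < length vs - 1"
  shows "{\<sigma> \<in> hull_cells V R {}. first_facet \<sigma> = i} =
         hull_cells (V - {vs ! i}) (R \<union> set (take i vs)) {}"
proof -
  have V: "set vs \<subseteq> V" using set_vs by blast
  have eq: "first_facet (convex hull G) = i \<longleftrightarrow> vs ! i \<notin> G \<and> set (take i vs) \<subseteq> G" if "G \<subseteq> V" for G
  proof -
    have "v \<in> convex hull G \<longleftrightarrow> v \<in> G" if "v \<in> set vs" for v
      using vertex_in_hull_iff[OF indep \<open>G \<subseteq> V\<close>] that V by blast
    moreover have "vs ! i \<in> set vs" "set (take i vs) \<subseteq> set vs"
      using assms by (auto dest: in_set_takeD)
    ultimately show ?thesis
      unfolding first_facet_eq_iff[OF assms] by blast
  qed
  have "{\<sigma> \<in> hull_cells V R {}. first_facet \<sigma> = i} =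
     (\<lambda>G. convex hull G) ` {G. R \<subseteq> G \<and> G \<subseteq> V \<and> \<not> G \<subseteq> {} \<and> first_facet (convex hull G) = i}"
    unfolding hull_cells_def by blast
  also have "{G. R \<subseteq> G \<and> G \<subseteq> V \<and> \<not> G \<subseteq> {} \<and> first_facet (convex hull G) = i} =
     {G. R \<union> set (take i vs) \<subseteq> G \<and> G \<subseteq> V - {vs ! i} \<and> \<not> G \<subseteq> {}}"
    using eq by (intro Collect_cong) blast
  finally show ?thesis unfolding hull_cells_def .
qed

lemma last_piece_eq:
  "{\<sigma> \<in> hull_cells V R {}. first_facet \<sigma> = length vs - 1} = {facet V (last vs), convex hull V}"
proof -
  have V: "set vs \<subseteq> V" using set_vs by blast
  have l: "last vs \<in> set vs" using vs_ne by simp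
  have eq: "first_facet (convex hull G) = length vs - 1 \<longleftrightarrow> set (butlast vs) \<subseteq> G" if "G \<subseteq> V" for G
  proof -
    have m: "v \<in> convex hull G \<longleftrightarrow> v \<in> G" if "v \<in> set vs" for v
      using vertex_in_hull_iff[OF indep \<open>G \<subseteq> V\<close>] that V by blast
    have "first_facet (convex hull G) = length vs - 1 \<longleftrightarrow> (\<forall>j<length vs - 1. vs ! j \<in> convex hull G)"
    proof
      assume f: "first_facet (convex hull G) = length vs - 1"
      have "vs ! j \<in> convex hull G" if "j < length vs - 1" for j
        using not_less_Least[of j "\<lambda>i. vs ! i \<notin> convex hull G \<or> i = length vs - 1"] f that
        unfolding first_facet_def by simp
      then show "\<forall>j<length vs - 1. vs ! j \<in> convex hull G" by blast
    next
      assume a: "\<forall>j<length vs - 1. vs ! j \<in> convex hull G"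
      show "first_facet (convex hull G) = length vs - 1"
        unfolding first_facet_def by (rule Least_equality) (use a not_le_imp_less in auto)
    qed
    also have "\<dots> \<longleftrightarrow> set (butlast vs) \<subseteq> convex hull G"
      by (auto simp: subset_iff in_set_conv_nth nth_butlast)
    also have "\<dots> \<longleftrightarrow> set (butlast vs) \<subseteq> G"
      using m by (meson in_set_butlastD subset_iff)
    finally show ?thesis .
  qed
  have bl: "set (butlast vs) = V - R - {last vs}"
    unfolding set_vs[symmetric] using dist vs_ne by (cases vs rule: rev_cases) auto
  have "R \<subseteq> G \<and> G \<subseteq> V \<and> \<not> G \<subseteq> {} \<and> first_facet (convex hull G) = length vs - 1 \<longleftrightarrow>
     G = V - {last vs} \<or> G = V" for G
  proof -
    have "V - {last vs} \<noteq> {}"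
    proof
      assume "V - {last vs} = {}"
      then have "card V \<le> card {last vs}" by (intro card_mono) auto
      then show False using card_V by simp
    qed
    then show ?thesis
    proof (cases "G \<subseteq> V")
      case True
      have "R \<subseteq> G \<and> G \<noteq> {} \<and> V - R - {last vs} \<subseteq> G \<longleftrightarrow> G = V - {last vs} \<or> G = V"
        if "V - {last vs} \<noteq> {}" using that l set_vs R_sub True by blast
      then show ?thesis
        using \<open>V - {last vs} \<noteq> {}\<close> True eq[OF True] unfolding bl by simp
    qed blast
  qed
  then have "{G. R \<subseteq> G \<and> G \<subseteq> V \<and> \<not> G \<subseteq> {} \<and> first_facet (convex hull G) = length vs - 1} =
     {V - {last vs}, V}" by (intro set_eqI) (simp only: mem_Collect_eq insert_iff empty_iff simp_thms)
  moreover have "{\<sigma> \<in> hull_cells V R {}. first_facet \<sigma> = length vs - 1} =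
     (\<lambda>G. convex hull G) ` {G. R \<subseteq> G \<and> G \<subseteq> V \<and> \<not> G \<subseteq> {} \<and> first_facet (convex hull G) = length vs - 1}"
    unfolding hull_cells_def by blast
  ultimately show ?thesis by (simp add: facet_def)
qed

end

text \<open>
  By induction the pieces of a tile carry acyclic matchings, and the piece index is monotone along
  faces, so that the gluing principle applies. For \<open>R \<noteq> V\<close>, an unmatched cell can only come from a
  piece with no removed facet. This can only be the first piece, and only when \<open>R = {}\<close>; following
  the first pieces down to dimension 0 leads to a single vertex.

  The last clause records that the value of \<open>W\<close> at a face has exactly one additional vertex.
\<close>

lemma basic_field_matching_aux:
  assumes "basic_field V R W"
  shows "acyclic_matching (hull_cells V R {}) W \<and>
    (R \<noteq> {} \<and> R \<noteq> V \<longrightarrow> unmatched (hull_cells V R {}) W = {}) \<and>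
    (R = {} \<longrightarrow> (\<exists>v\<in>V. unmatched (hull_cells V R {}) W = {{v}})) \<and>
    (R = V \<longrightarrow> unmatched (hull_cells V R {}) W = {convex hull V}) \<and>
    (\<forall>\<sigma> \<tau>. W \<sigma> = Some \<tau> \<longrightarrow> (\<exists>G v. R \<subseteq> G \<and> G \<subseteq> V \<and> v \<in> V - G \<and>
       \<sigma> = convex hull G \<and> \<tau> = convex hull (insert v G)))"
  using assms
proof (induction rule: basic_field.induct)
  case (point V R)
  then obtain v where v: "V = {v}" using card_1_singletonE by blast
  have "R \<subseteq> V" using point by (simp add: is_basic_datum_def)
  then have "{G. R \<subseteq> G \<and> G \<subseteq> V \<and> \<not> G \<subseteq> {}} = {V}" unfolding v by blast
  then have "hull_cells V R {} = {{v}}" by (simp add: hull_cells_def v)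
  moreover have "R = {} \<or> R = V" using \<open>R \<subseteq> V\<close> v by blast
  ultimately show ?case
    by (auto simp: acyclic_matching_empty unmatched_def v)
next
  case (open_simplex V)
  then have "{G. V \<subseteq> G \<and> G \<subseteq> V \<and> \<not> G \<subseteq> {}} = {V}" by (auto simp: is_basic_datum_def)
  then have "hull_cells V V {} = {convex hull V}" by (simp add: hull_cells_def)
  moreover have "V \<noteq> {}" using open_simplex by (simp add: is_basic_datum_def)
  ultimately show ?case by (simp add: acyclic_matching_empty unmatched_def)
next
  case (step V R vs W)
  interpret facet_ordering V R vs
    by unfold_locales (use step in auto)
  let ?C = "hull_cells V R {}" and ?m = "length vs - 1"
  let ?P = "\<lambda>i. {\<sigma> \<in> ?C. first_facet \<sigma> = i}"
  let ?V = "\<lambda>i. V - {vs ! i}" and ?R = "\<lambda>i. R \<union> set (take i vs)"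
  let ?f = "facet V (last vs)" and ?h = "convex hull V"
  have dom: "dom W \<subseteq> ?C"
    using step.hyps by (simp add: open_cells_basic_tile)
  have cells: "open_cells (faces (facet V (vs ! i))) (basic_tile (?V i) (?R i)) = ?P i"
    and hull: "hull_cells (?V i) (?R i) {} = ?P i" if "i < ?m" for i
    using open_cells_basic_tile[OF piece_datum(1)[OF that]] piece_eq[OF that]
    by (simp_all add: facet_def)
  have IH_matching: "acyclic_matching (?P i) (W |` ?P i)" if "i < ?m" for i
    using step.IH[OF that] unfolding cells[OF that] hull[OF that] by blast
  have IH_none: "unmatched (?P i) (W |` ?P i) = {}" if "i < ?m" "?R i \<noteq> {}" for i
    by (rule step.IH[OF that(1), unfolded cells[OF that(1)] hull[OF that(1)],
          THEN conjunct2, THEN conjunct1, THEN mp, OF conjI[OF that(2) piece_datum(2)[OF that(1)]]])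
  have IH_vertex: "\<exists>v\<in>?V i. unmatched (?P i) (W |` ?P i) = {{v}}" if "i < ?m" "?R i = {}" for i
    by (rule step.IH[OF that(1), unfolded cells[OF that(1)] hull[OF that(1)],
          THEN conjunct2, THEN conjunct2, THEN conjunct1, THEN mp, OF that(2)])
  have IH_insert: "\<exists>G v. ?R i \<subseteq> G \<and> G \<subseteq> ?V i \<and> v \<in> ?V i - G \<and>
       \<sigma> = convex hull G \<and> \<tau> = convex hull (insert v G)"
    if "i < ?m" "(W |` ?P i) \<sigma> = Some \<tau>" for i \<sigma> \<tau>
    by (rule step.IH[OF that(1), unfolded cells[OF that(1)] hull[OF that(1)],
          THEN conjunct2, THEN conjunct2, THEN conjunct2, THEN conjunct2,
          rule_format, OF that(2)])
  have l: "last vs \<in> V - R" using vs_ne set_vs last_in_set by blast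
  then have "V - {last vs} \<noteq> V" by blast
  then have fh: "?f \<noteq> ?h"
    unfolding facet_def using hull_eq_iff[OF indep, of "V - {last vs}" V] by blast
  have last: "W |` ?P ?m = [?f \<mapsto> ?h]"
    unfolding last_piece_eq using step.hyps(7,8) by (auto simp: restrict_map_def)
  have last_matching: "acyclic_matching {?f, ?h} [?f \<mapsto> ?h]" "unmatched {?f, ?h} [?f \<mapsto> ?h] = {}"
  proof -
    have "flow [?f \<mapsto> ?h] = {}" by (auto simp: flow_def split: if_splits)
    then show "acyclic_matching {?f, ?h} [?f \<mapsto> ?h]" "unmatched {?f, ?h} [?f \<mapsto> ?h] = {}"
      using fh by (auto simp: acyclic_matching_def unmatched_def)
  qed
  have none: "?P i = {}" if "?m < i" for i
  proof -
    have "first_facet \<sigma> \<noteq> i" for \<sigma> using first_facet_le[of \<sigma>] that by linarith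
    then show ?thesis by simp
  qed
  have layer: "acyclic_matching (?P i) (W |` ?P i)" for i
  proof (cases i ?m rule: linorder_cases)
    case equal
    show ?thesis unfolding equal last unfolding last_piece_eq by (rule last_matching)
  next
    case greater
    show ?thesis unfolding none[OF greater] by (simp add: acyclic_matching_empty)
  qed (rule IH_matching)
  have mono: "first_facet \<sigma> \<le> first_facet \<tau>" if "\<sigma> face_of \<tau>" for \<sigma> \<tau>
    using that by (intro first_facet_mono face_of_imp_subset)
  have "unmatched ?C W = (\<Union>i. unmatched (?P i) (W |` ?P i))"
    by (rule unmatched_glue[OF dom layer mono])
  also have "\<dots> = (\<Union>i<?m. unmatched (?P i) (W |` ?P i))"
  proof -
    have "unmatched (?P i) (W |` ?P i) = {}" if "\<not> i < ?m" for i
    proof (cases "i = ?m")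
      case True
      show ?thesis unfolding True last unfolding last_piece_eq by (rule last_matching)
    next
      case False
      then have "?P i = {}" using that by (intro none) linarith
      then show ?thesis by (auto simp only: unmatched_def)
    qed
    then show ?thesis by blast
  qed
  finally have un: "unmatched ?C W = (\<Union>i<?m. unmatched (?P i) (W |` ?P i))" .
  have "unmatched ?C W = {}" if "R \<noteq> {}"
    unfolding un using IH_none that by simp
  moreover have "\<exists>v\<in>V. unmatched ?C W = {{v}}" if R0: "R = {}"
  proof -
    have "length vs = card V"
      using distinct_card[OF dist] set_vs R0 by simp
    then have m: "0 < ?m" using card_V by simp
    then obtain v where v: "v \<in> V" "unmatched (?P 0) (W |` ?P 0) = {{v}}"
      using IH_vertex[of 0] R0 by auto
    have "unmatched (?P i) (W |` ?P i) = {}" if "i < ?m" "i \<noteq> 0" for i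
      using IH_none[of i] that vs_ne by simp
    then have "(\<Union>i<?m. unmatched (?P i) (W |` ?P i)) = (\<Union>i\<in>{0}. unmatched (?P i) (W |` ?P i))"
      using m by (intro SUP_eq) (blast, blast)
    then have "unmatched ?C W = {{v}}"
      unfolding un v(2)[symmetric] by simp
    then show ?thesis using v(1) by blast
  qed
  moreover have "\<exists>G v. R \<subseteq> G \<and> G \<subseteq> V \<and> v \<in> V - G \<and> \<sigma> = convex hull G \<and> \<tau> = convex hull (insert v G)"
    if W: "W \<sigma> = Some \<tau>" for \<sigma> \<tau>
  proof -
    have \<sigma>: "\<sigma> \<in> ?P (first_facet \<sigma>)" using W dom by auto
    then have W': "(W |` ?P (first_facet \<sigma>)) \<sigma> = Some \<tau>" using W by simp
    show ?thesis
    proof (cases "first_facet \<sigma> < ?m")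
      case True
      then show ?thesis using IH_insert[OF True W'] by blast
    next
      case False
      then have "first_facet \<sigma> = ?m" using first_facet_le le_neq_implies_less by blast
      then have "\<sigma> = ?f" "\<tau> = ?h" using W' last by (auto split: if_splits)
      moreover have "insert (last vs) (V - {last vs}) = V" using l by blast
      ultimately show ?thesis
        using l R_sub unfolding facet_def
        by (intro exI[of _ "V - {last vs}"] exI[of _ "last vs"]) auto
    qed
  qed
  ultimately show ?case
    using acyclic_matching_glue[OF dom layer mono] R_ne by blast
qed

lemma
  assumes "basic_field V R W"
  shows basic_field_matching: "acyclic_matching (hull_cells V R {}) W"
    and basic_field_unmatched_empty:
      "R \<noteq> {} \<Longrightarrow> R \<noteq> V \<Longrightarrow> unmatched (hull_cells V R {}) W = {}"
    and basic_field_unmatched_vertex: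
      "R = {} \<Longrightarrow> \<exists>v\<in>V. unmatched (hull_cells V R {}) W = {{v}}"
    and basic_field_unmatched_top:
      "R = V \<Longrightarrow> unmatched (hull_cells V R {}) W = {convex hull V}"
    and basic_field_insert:
      "W \<sigma> = Some \<tau> \<Longrightarrow> \<exists>G v. R \<subseteq> G \<and> G \<subseteq> V \<and> v \<in> V - G \<and>
        \<sigma> = convex hull G \<and> \<tau> = convex hull (insert v G)"
  using basic_field_matching_aux[OF assms] by (elim conjE; simp; fail)+

section \<open>Fields on Morse tiles\<close>

text \<open>
  An interior point of the face spanned by \<open>R\<close> avoids the facets opposite to the vertices in \<open>R\<close>.
\<close>

lemma is_morse_datum_diagonal:
  assumes "\<not> affine_dependent V" "R \<subset> V"
  shows "is_morse_datum V R R"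
proof -
  have fin: "finite V" using assms(1) by (rule aff_independent_finite)
  have "\<not> convex hull R \<subseteq> (\<Union>v\<in>R. facet V v)" if "R \<noteq> {}"
  proof
    assume sub: "convex hull R \<subseteq> (\<Union>v\<in>R. facet V v)"
    have "rel_interior (convex hull R) \<noteq> {}"
      using that by (simp add: rel_interior_eq_empty)
    then obtain x where x: "x \<in> rel_interior (convex hull R)" by blast
    then obtain v where v: "v \<in> R" "x \<in> convex hull (V - {v})"
      using sub rel_interior_subset unfolding facet_def by blast
    then have "R \<subseteq> V - {v}"
      using rel_interior_hull_meets_hull_iff[OF assms(1) _ _ that, of "V - {v}"] x assms(2) by blast
    then show False using v(1) by blast
  qed
  moreover have "card R < card V" using psubset_card_mono[OF fin assms(2)] .
  ultimately show ?thesis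
    using assms by (auto simp: is_morse_datum_def is_basic_datum_def)
qed

lemma critical_tile_diagonal:
  assumes "\<not> affine_dependent V" "R \<subset> V"
  shows "critical_tile (card R) (morse_tile_set V R R)"
proof -
  have "card V \<noteq> 0" using assms aff_independent_finite[OF assms(1)] by auto
  then show ?thesis
    unfolding critical_tile_def morse_tile_def
    using is_morse_datum_diagonal[OF assms]
    by (intro exI[of _ "card V - 1"] exI[of _ V] exI[of _ R]) auto
qed

lemma critical_tileE:
  assumes "critical_tile k T"
  obtains V R where "\<not> affine_dependent V" "R \<subset> V" "T = morse_tile_set V R R"
proof -
  obtain n V R U where d: "is_morse_datum V R U" "int (card U) = int k" "card R = k"
      "T = morse_tile_set V R U"
    using assms unfolding critical_tile_def morse_tile_def by auto
  have s: "R \<subseteq> U" "U \<subset> V" and V: "\<not> affine_dependent V"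
    using morse_datum_subset[OF d(1)] d(1) by (auto simp: is_morse_datum_def is_basic_datum_def)
  then have "finite U" using aff_independent_finite finite_subset by blast
  then have "R = U" using s(1) d(2,3) card_subset_eq by auto
  then show ?thesis using that s V d(4) by blast
qed

text \<open>
  The open simplex is the critical tile of top index: removing all the facets amounts to
  removing those opposite to the vertices of one facet, and then that facet.
\<close>

lemma basic_tile_all_facets:
  assumes "v \<in> V"
  shows "basic_tile V V = morse_tile_set V (V - {v}) (V - {v})"
  using assms unfolding basic_tile_def morse_tile_set_def facet_def by blast

lemma simplex_hull_insert:
  fixes V :: "'a::euclidean_space set"
  assumes "\<not> affine_dependent V" "G \<subseteq> V" "v \<in> V - G"
  shows "int (card G) simplex (convex hull (insert v G))"
proof -
  have "\<not> affine_dependent (insert v G)"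
    using affine_independent_subset[OF assms(1)] assms by blast
  moreover have "finite G" using assms(1,2) aff_independent_finite finite_subset by blast
  ultimately show ?thesis
    using assms(3) by (auto simp: simplex_def intro!: exI[of _ "insert v G"])
qed

lemma hull_in_hull_cells_iff:
  fixes V :: "'a::euclidean_space set"
  assumes "\<not> affine_dependent V" "G \<subseteq> V"
  shows "convex hull G \<in> hull_cells V R U \<longleftrightarrow> R \<subseteq> G \<and> \<not> G \<subseteq> U"
proof
  assume "convex hull G \<in> hull_cells V R U"
  then obtain H where H: "R \<subseteq> H" "H \<subseteq> V" "\<not> H \<subseteq> U" "convex hull G = convex hull H"
    unfolding hull_cells_def by blast
  then have "G = H" using hull_eq_iff[OF assms] by simp
  then show "R \<subseteq> G \<and> \<not> G \<subseteq> U" using H by blast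
qed (use assms(2) in \<open>auto simp: hull_cells_def\<close>)

text \<open>
  Leaving the removed face is irreversible, as \<open>Y\<close> only adds vertices.
\<close>

lemma basic_field_preserves_hull_cells:
  assumes V: "\<not> affine_dependent V" and Y: "basic_field V R Y"
  shows "preserves_cells Y (hull_cells V R U)"
  unfolding preserves_cells_def
proof (intro ballI allI impI)
  fix \<sigma> \<tau> assume a: "\<sigma> \<in> hull_cells V R U" "Y \<sigma> = Some \<tau>"
  obtain G v where G: "R \<subseteq> G" "G \<subseteq> V" "v \<in> V - G"
      "\<sigma> = convex hull G" "\<tau> = convex hull (insert v G)"
    using basic_field_insert[OF Y a(2)] by blast
  have "insert v G \<subseteq> V" using G(2,3) by blast
  moreover have "\<not> G \<subseteq> U" using a(1) G(2) unfolding G(4) by (simp add: hull_in_hull_cells_iff[OF V])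
  ultimately show "\<tau> \<in> hull_cells V R U"
    unfolding G(5) using G(1) by (subst hull_in_hull_cells_iff[OF V]) auto
qed

lemma unmatched_delete_source:
  assumes C: "unmatched C W = {}" "dom W \<subseteq> C" and D: "D = C - {\<sigma>}"
    and \<sigma>: "W \<sigma> = Some \<tau>" and m: "acyclic_matching C W"
  shows "unmatched D (W |` D) = {\<tau>}"
proof -
  have inj: "\<nu> = \<sigma>" if "W \<nu> = Some \<tau>" for \<nu>
    using m \<sigma> that unfolding acyclic_matching_def by (metis domI inj_onD)
  have nd: "W \<rho> = None" if "W \<nu> = Some \<rho>" for \<nu> \<rho>
    using m that unfolding acyclic_matching_def by (metis disjoint_iff domIff ranI)
  have "\<tau> \<in> C" using m \<sigma> unfolding acyclic_matching_def by (meson ranI subsetD)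
  have "\<tau> \<noteq> \<sigma>" using nd[OF \<sigma>] \<sigma> by auto
  have "\<rho> \<in> unmatched D (W |` D) \<longleftrightarrow> \<rho> = \<tau>" for \<rho>
  proof
    assume "\<rho> \<in> unmatched D (W |` D)"
    then have \<rho>: "\<rho> \<in> C" "\<rho> \<notin> dom W" "\<rho> \<notin> ran (W |` D)"
      unfolding unmatched_def D by auto
    then have "\<rho> \<in> ran W" using C(1) unfolding unmatched_def by blast
    then obtain \<nu> where \<nu>: "W \<nu> = Some \<rho>" by (auto simp: ran_def)
    have "\<nu> \<notin> D"
    proof
      assume "\<nu> \<in> D"
      then have "(W |` D) \<nu> = Some \<rho>" using \<nu> by simp
      then show False using \<rho>(3) by (auto simp: ran_def)
    qed
    then have "\<nu> = \<sigma>" using C(2) \<nu> unfolding D by blast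
    then show "\<rho> = \<tau>" using \<nu> \<sigma> by simp
  next
    assume "\<rho> = \<tau>"
    moreover have "\<tau> \<notin> ran (W |` D)"
    proof
      assume "\<tau> \<in> ran (W |` D)"
      then obtain \<nu> where "\<nu> \<in> D" "W \<nu> = Some \<tau>"
        by (auto simp: ran_def restrict_map_def split: if_splits)
      then show False using inj D by blast
    qed
    ultimately show "\<rho> \<in> unmatched D (W |` D)"
      using \<open>\<tau> \<in> C\<close> \<open>\<tau> \<noteq> \<sigma>\<close> nd[OF \<sigma>] unfolding unmatched_def D by auto
  qed
  then show ?thesis by blast
qed

text \<open>
  The removed part of a critical tile is one cell, the open face spanned by \<open>R\<close>. When \<open>R \<noteq> {}\<close>, this
  cell has the fewest vertices of all and therefore is matched with a cell of one dimension more,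
  which loses its partner in the critical tile.
\<close>

lemma critical_field_unmatched:
  assumes V: "\<not> affine_dependent V" and R: "R \<subset> V" and Y: "basic_field V R Y"
  shows "\<exists>\<sigma>. unmatched (hull_cells V R R) (Y |` hull_cells V R R) = {\<sigma>} \<and> int (card R) simplex \<sigma>"
proof (cases "R = {}")
  case True
  have "dom Y \<subseteq> hull_cells V {} {}"
    using basic_field_matching[OF Y] unfolding True acyclic_matching_def by blast
  then have "Y |` hull_cells V {} {} = Y"
    by (auto simp: fun_eq_iff restrict_map_def) (metis domIff subsetD)
  then show ?thesis
    using basic_field_unmatched_vertex[OF Y True] zero_simplex_sing unfolding True by auto
next
  case False
  note m = basic_field_matching[OF Y]
  have none: "unmatched (hull_cells V R {}) Y = {}"
    using basic_field_unmatched_empty[OF Y False] R by blast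
  have not_ran: "convex hull R \<notin> ran Y"
  proof
    assume "convex hull R \<in> ran Y"
    then obtain \<nu> where \<nu>: "Y \<nu> = Some (convex hull R)" by (auto simp: ran_def)
    then obtain G v where G: "R \<subseteq> G" "G \<subseteq> V" "v \<in> V - G" "convex hull R = convex hull (insert v G)"
      using basic_field_insert[OF Y \<nu>] by blast
    have "R = insert v G"
      using hull_eq_iff[THEN iffD1, OF V _ _ G(4)] G(2,3) R by blast
    then show False using G by blast
  qed
  have "convex hull R \<in> hull_cells V R {}"
    using R False by (subst hull_in_hull_cells_iff[OF V]) auto
  then have "convex hull R \<in> dom Y"
    using none not_ran unfolding unmatched_def by blast
  then obtain \<tau> where \<tau>: "Y (convex hull R) = Some \<tau>" by blast
  then obtain G v where G: "G \<subseteq> V" "v \<in> V - G" "convex hull R = convex hull G"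
      "\<tau> = convex hull (insert v G)"
    using basic_field_insert[OF Y \<tau>] by blast
  have "G = R" using hull_eq_iff[THEN iffD1, OF V _ _ G(3)] G(1) R by blast
  have "int (card R) simplex \<tau>"
    using simplex_hull_insert[OF V G(1,2)] unfolding G(4) \<open>G = R\<close> .
  moreover have "hull_cells V R R = hull_cells V R {} - {convex hull R}"
  proof -
    have "\<sigma> \<in> hull_cells V R R \<longleftrightarrow> \<sigma> \<in> hull_cells V R {} - {convex hull R}" for \<sigma>
    proof (cases "\<exists>G\<subseteq>V. \<sigma> = convex hull G")
      case True
      then obtain G where G: "G \<subseteq> V" "\<sigma> = convex hull G" by blast
      have "R \<subseteq> G \<and> \<not> G \<subseteq> R \<longleftrightarrow> (R \<subseteq> G \<and> \<not> G \<subseteq> {}) \<and> G \<noteq> R"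
        using False by blast
      then show ?thesis
        using R unfolding G(2) by (simp add: hull_in_hull_cells_iff[OF V G(1)] hull_eq_iff[OF V G(1)])
    qed (auto simp: hull_cells_def)
    then show ?thesis by (rule set_eqI)
  qed
  moreover have "dom Y \<subseteq> hull_cells V R {}" using m by (simp add: acyclic_matching_def)
  ultimately show ?thesis
    using unmatched_delete_source[OF none _ _ \<tau> m] by (intro exI[of _ \<tau>] conjI)
qed

text \<open>
  As \<open>Y\<close> preserves the removed face, no cell of the tile loses its partner, and at most one cell is
  unmatched. Since \<open>R \<subset> U \<subset> V\<close>, the number of cells is even, so there is no unmatched cell at all.
\<close>

lemma regular_field_unmatched:
  assumes V: "\<not> affine_dependent V" and RU: "R \<subset> U" "U \<subset> V" and Y: "basic_field V R Y"
    and pres: "preserves_cells Y (open_cells (faces (convex hull V)) (removed_face V R U))"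
  shows "even (card (hull_cells V R U))"
    and "unmatched (hull_cells V R U) (Y |` hull_cells V R U) = {}"
proof -
  let ?C = "hull_cells V R U" and ?B = "hull_cells V R {}"
  have fin: "finite V" using V by (rule aff_independent_finite)
  have "V - R \<noteq> {}" "U - R \<noteq> {}" "finite (V - R)" "finite (U - R)"
    using RU fin finite_subset[of U V] by auto
  then have "card (V - R) \<noteq> 0" "card (U - R) \<noteq> 0" by simp_all
  then have even: "even (card ?C)"
    using card_hull_cells[OF V, of R U] RU by (simp add: psubset_eq subset_trans[of R U V])
  show "even (card ?C)" by (rule even)
  have m: "acyclic_matching ?C (Y |` ?C)"
    using acyclic_matching_restrict basic_field_matching[OF Y] basic_field_preserves_hull_cells[OF V Y]
    by blast
  have removed: "open_cells (faces (convex hull V)) (removed_face V R U) = ?B - ?C"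
  proof -
    have "R \<subseteq> V" "U \<subseteq> V" using RU by auto
    then have "open_cells (faces (convex hull V)) (removed_face V R U) =
        (\<lambda>G. convex hull G) ` {G. R \<subseteq> G \<and> G \<subseteq> U \<and> G \<noteq> {}}"
      by (rule open_cells_removed_face[OF V])
    also have "\<dots> = ?B - ?C"
    proof (rule set_eqI)
      fix \<sigma>
      show "\<sigma> \<in> (\<lambda>G. convex hull G) ` {G. R \<subseteq> G \<and> G \<subseteq> U \<and> G \<noteq> {}} \<longleftrightarrow> \<sigma> \<in> ?B - ?C"
      proof
        assume "\<sigma> \<in> (\<lambda>G. convex hull G) ` {G. R \<subseteq> G \<and> G \<subseteq> U \<and> G \<noteq> {}}"
        then obtain G where "R \<subseteq> G" "G \<subseteq> U" "G \<noteq> {}" "\<sigma> = convex hull G" by blast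
        then show "\<sigma> \<in> ?B - ?C" using \<open>U \<subseteq> V\<close> by (simp add: hull_in_hull_cells_iff[OF V])
      next
        assume a: "\<sigma> \<in> ?B - ?C"
        then obtain G where "R \<subseteq> G" "G \<subseteq> V" "G \<noteq> {}" "\<sigma> = convex hull G"
          unfolding hull_cells_def by blast
        then show "\<sigma> \<in> (\<lambda>G. convex hull G) ` {G. R \<subseteq> G \<and> G \<subseteq> U \<and> G \<noteq> {}}"
          using a by (auto simp: hull_in_hull_cells_iff[OF V])
      qed
    qed
    finally show ?thesis .
  qed
  have dom: "dom Y \<subseteq> ?B" and ran: "ran Y \<subseteq> ?B"
    using basic_field_matching[OF Y] unfolding acyclic_matching_def by auto
  have sub: "unmatched ?C (Y |` ?C) \<subseteq> unmatched ?B Y"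
  proof
    fix \<rho> assume \<rho>: "\<rho> \<in> unmatched ?C (Y |` ?C)"
    have "\<rho> \<in> ?C" "\<rho> \<notin> dom Y" "\<rho> \<notin> ran (Y |` ?C)"
      using \<rho> unfolding unmatched_def by auto
    moreover have "?C \<subseteq> ?B" unfolding hull_cells_def by blast
    moreover have "Y \<nu> \<noteq> Some \<rho>" for \<nu>
    proof
      assume n: "Y \<nu> = Some \<rho>"
      have "\<nu> \<notin> ?C"
      proof
        assume "\<nu> \<in> ?C"
        then have "(Y |` ?C) \<nu> = Some \<rho>" using n by simp
        then show False using \<open>\<rho> \<notin> ran (Y |` ?C)\<close> by (auto simp: ran_def)
      qed
      then have "\<nu> \<in> ?B - ?C" using n dom by blast
      then have "\<rho> \<in> ?B - ?C" using pres n unfolding removed preserves_cells_def by blast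
      then show False using \<open>\<rho> \<in> ?C\<close> by blast
    qed
    ultimately show "\<rho> \<in> unmatched ?B Y" unfolding unmatched_def ran_def by blast
  qed
  have "R \<noteq> V" using RU by blast
  then obtain \<sigma> where "unmatched ?B Y \<subseteq> {\<sigma>}"
    using basic_field_unmatched_empty[OF Y] basic_field_unmatched_vertex[OF Y] by (cases "R = {}") auto
  then have "unmatched ?C (Y |` ?C) \<subseteq> {\<sigma>}" using sub by blast
  moreover have "even (card (unmatched ?C (Y |` ?C)))"
    using even_card_iff_even_unmatched[OF finite_hull_cells[OF V] m] even by blast
  ultimately show "unmatched ?C (Y |` ?C) = {}"
    by (metis card.empty card_insert_disjoint empty_iff finite.emptyI odd_one One_nat_def subset_singletonD)
qed

text \<open>
  A tile may be presented by different vertex data, and it has to be excluded that one presentation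
  is critical while a field without critical cells lives on another. For this reason the
  conclusion in the case without critical cells contains the parity of the number of cells, which
  is intrinsic to the tile.
\<close>

lemma field_on_tile_matching:
  assumes "field_on_basic_tile T X \<or> field_on_critical_tile T X \<or> field_on_regular_tile T X"
  obtains V R U where "\<not> affine_dependent V" "R \<subseteq> V" "U \<subset> V" "T = morse_tile_set V R U"
    "acyclic_matching (hull_cells V R U) X"
    "even (card (hull_cells V R U)) \<and> unmatched (hull_cells V R U) X = {} \<or>
     (\<exists>\<sigma> k. unmatched (hull_cells V R U) X = {\<sigma>} \<and> int k simplex \<sigma> \<and> critical_tile k T)"
  using assms
proof (elim disjE)
  assume "field_on_basic_tile T X"
  then obtain V R where d: "is_basic_datum V R" and T: "T = basic_tile V R" and X: "basic_field V R X"
    unfolding field_on_basic_tile_def by blast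
  have V: "\<not> affine_dependent V" "V \<noteq> {}" "R \<subseteq> V" using d by (auto simp: is_basic_datum_def)
  note m = basic_field_matching[OF X]
  have "even (card (hull_cells V R {})) \<and> unmatched (hull_cells V R {}) X = {} \<or>
     (\<exists>\<sigma> k. unmatched (hull_cells V R {}) X = {\<sigma>} \<and> int k simplex \<sigma> \<and> critical_tile k T)"
  proof (cases "R = {} \<or> R = V")
    case False
    then have "unmatched (hull_cells V R {}) X = {}" using basic_field_unmatched_empty[OF X] by blast
    then show ?thesis
      using even_card_iff_even_unmatched[OF finite_hull_cells[OF V(1)] m] by simp
  next
    case True
    then show ?thesis
    proof
      assume R: "R = {}"
      obtain v where "unmatched (hull_cells V R {}) X = {{v}}"
        using basic_field_unmatched_vertex[OF X R] by blast
      moreover have "int 0 simplex {v}" using zero_simplex_sing by simp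
      moreover have "critical_tile 0 T"
        using critical_tile_diagonal[OF V(1), of "{}"] V(2)
        unfolding T R basic_tile_conv_morse_tile_set by auto
      ultimately show ?thesis by blast
    next
      assume R: "R = V"
      obtain v where v: "v \<in> V" using V(2) by blast
      then have ins: "insert v (V - {v}) = V" by blast
      have "int (card (V - {v})) simplex (convex hull V)"
        using simplex_hull_insert[OF V(1), of "V - {v}" v] v unfolding ins by blast
      moreover have "critical_tile (card (V - {v})) T"
        unfolding T R basic_tile_all_facets[OF v] using v by (intro critical_tile_diagonal V(1)) blast
      ultimately show ?thesis using basic_field_unmatched_top[OF X R] by blast
    qed
  qed
  then show thesis
    using V m T that[of V R "{}"] by (auto simp: basic_tile_conv_morse_tile_set)
next
  assume "field_on_critical_tile T X"
  then obtain V R U Y where d: "is_morse_datum V R U" "card U = card R" and T: "T = morse_tile_set V R U"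
      and Y: "basic_field V R Y" and X: "X = Y |` open_cells (faces (convex hull V)) T"
    unfolding field_on_critical_tile_def by blast
  have s: "R \<subseteq> U" "U \<subset> V" and V: "\<not> affine_dependent V"
    using morse_datum_subset[OF d(1)] d(1) by (auto simp: is_morse_datum_def is_basic_datum_def)
  then have "finite U" using aff_independent_finite finite_subset by blast
  then have U: "U = R" using s(1) d(2) card_subset_eq by metis
  have R: "R \<subset> V" "R \<subseteq> V" using s U by auto
  have X: "X = Y |` hull_cells V R R"
    unfolding X T U open_cells_morse_tile_set[OF V R(2) R(2)] ..
  have "acyclic_matching (hull_cells V R R) X"
    unfolding X by (rule acyclic_matching_restrict[OF basic_field_matching[OF Y]
          basic_field_preserves_hull_cells[OF V Y]])
  moreover have "\<exists>\<sigma> k. unmatched (hull_cells V R R) X = {\<sigma>} \<and> int k simplex \<sigma> \<and> critical_tile k T"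
    using critical_field_unmatched[OF V R(1) Y] critical_tile_diagonal[OF V R(1)]
    unfolding X T U by blast
  ultimately show thesis
    using that[of V R R] V R T U by blast
next
  assume "field_on_regular_tile T X"
  then obtain V R U Y where d: "is_morse_datum V R U" "card U \<noteq> card R" and T: "T = morse_tile_set V R U"
      and Y: "basic_field V R Y" and X: "X = Y |` open_cells (faces (convex hull V)) T"
      and pres: "preserves_cells Y (open_cells (faces (convex hull V)) (removed_face V R U))"
    unfolding field_on_regular_tile_def by blast
  have s: "R \<subset> U" "U \<subset> V" and V: "\<not> affine_dependent V"
    using morse_datum_subset[OF d(1)] d by (auto simp: is_morse_datum_def is_basic_datum_def)
  then have s': "R \<subseteq> V" "U \<subseteq> V" by auto
  have X: "X = Y |` hull_cells V R U"
    unfolding X T open_cells_morse_tile_set[OF V s'] ..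
  have "acyclic_matching (hull_cells V R U) X"
    unfolding X by (rule acyclic_matching_restrict[OF basic_field_matching[OF Y]
          basic_field_preserves_hull_cells[OF V Y]])
  then show thesis
    using that[of V R U] V s s' T regular_field_unmatched[OF V s Y pres] unfolding X by blast
qed

section \<open>Discrete Morse functions from acyclic matchings\<close>

text \<open>
  The number of predecessors under the transitive closure is such a rank.
\<close>

lemma finite_wf_rank:
  assumes "finite r" "wf r"
  obtains f :: "'b \<Rightarrow> nat" where "\<And>x y. (x, y) \<in> r \<Longrightarrow> f x < f y"
proof -
  have acyc: "(x, x) \<notin> r\<^sup>+" for x
    using wf_acyclic[OF assms(2)] by (simp add: acyclic_def)
  have "card {z. (z, x) \<in> r\<^sup>+} < card {z. (z, y) \<in> r\<^sup>+}" if "(x, y) \<in> r" for x y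
  proof (rule psubset_card_mono)
    have "{z. (z, y) \<in> r\<^sup>+} \<subseteq> fst ` (r\<^sup>+)" by force
    then show "finite {z. (z, y) \<in> r\<^sup>+}"
      using assms(1) finite_subset by (metis finite_imageI finite_trancl)
    show "{z. (z, x) \<in> r\<^sup>+} \<subset> {z. (z, y) \<in> r\<^sup>+}"
      using that acyc[of x] trancl_into_trancl[of _ x r y] r_into_trancl[OF that] by blast
  qed
  then show thesis by (rule that)
qed

lemma simplicial_complex_dim:
  assumes "simplicial_complex K" "\<sigma> \<in> K" "\<sigma> \<noteq> {}"
  obtains p where "\<sigma> \<in> dim_simplices K p"
proof -
  obtain n where n: "n simplex \<sigma>" using assms(1,2) unfolding simplicial_complex_def by blast
  then have "n \<noteq> -1" using assms(3) simplex_minus_1 by auto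
  then have "0 \<le> n" using simplex_dim_ge[OF n] by linarith
  then show thesis using that n assms(2) by (auto simp: dim_simplices_def)
qed

text \<open>
  It suffices that \<open>f \<tau> \<le> f \<sigma>\<close> holds exactly for \<open>W \<sigma> = Some \<tau>\<close>, whenever \<open>\<sigma>\<close> is a facet of \<open>\<tau>\<close>. Let
  \<open>f\<close> be the dimension at critical simplices, and at a matched pair of dimensions \<open>p\<close> and \<open>p + 1\<close> let
  it have one common value strictly between \<open>p\<close> and \<open>p + 1\<close>. Comparing dimensions settles all
  facets except \<open>\<sigma> \<in> dom W\<close> of \<open>\<tau> = W \<nu>\<close> with \<open>\<sigma> \<noteq> \<nu>\<close>. There the value at \<open>\<sigma>\<close> has to be smaller than
  the one at \<open>\<nu>\<close>, which a rank along gradient paths provides.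
\<close>

lemma acyclic_field_is_gradient:
  assumes K: "simplicial_complex K" and W: "discrete_vector_field K W"
    and m: "acyclic_matching (K - {{}}) W"
  shows "\<exists>f. discrete_morse_function K f \<and> self_indexing K f \<and> W = gradient_field K f"
proof -
  have finK: "finite K" using K by (simp add: simplicial_complex_def)
  have dom: "dom W \<subseteq> K - {{}}" using m by (simp add: acyclic_matching_def)
  have face: "\<sigma> face_of \<tau>" if "W \<sigma> = Some \<tau>" for \<sigma> \<tau>
    using W that by (auto simp: discrete_vector_field_def)
  have up: "\<tau> \<in> dim_simplices K (p + 1)" if "\<sigma> \<in> dim_simplices K p" "W \<sigma> = Some \<tau>" for \<sigma> \<tau> p
    using W that unfolding discrete_vector_field_def by blast
  have dim: "aff_dim \<sigma> = p" if "\<sigma> \<in> dim_simplices K p" for \<sigma> p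
    using that by (auto simp: dim_simplices_def aff_dim_simplex)
  have "flow W \<subseteq> dom W \<times> dom W" by (auto simp: flow_def)
  moreover have "finite (dom W)" using dom finK finite_subset by blast
  ultimately have "finite (flow W)" using finite_subset by blast
  moreover have "wf (flow W)" using m by (simp add: acyclic_matching_def)
  ultimately obtain r :: "'a set \<Rightarrow> nat" where r: "\<And>\<sigma> \<nu>. (\<sigma>, \<nu>) \<in> flow W \<Longrightarrow> r \<sigma> < r \<nu>"
    using finite_wf_rank by metis
  \<comment> \<open>Any increasing function of the rank with values in the open unit interval would do.\<close>
  define h where "h \<sigma> = 1 - 1 / (real (r \<sigma>) + 2)" for \<sigma>
  have h01: "0 < h \<sigma>" "h \<sigma> < 1" for \<sigma> by (auto simp: h_def field_simps)
  have h_mono: "h \<sigma> < h \<nu>" if "(\<sigma>, \<nu>) \<in> flow W" for \<sigma> \<nu>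
    using r[OF that] by (simp add: h_def field_simps)
  define source where "source \<tau> = (THE \<sigma>. W \<sigma> = Some \<tau>)" for \<tau>
  have source: "source \<tau> = \<sigma>" if "W \<sigma> = Some \<tau>" for \<sigma> \<tau>
    unfolding source_def
  proof (rule the_equality)
    show "W \<sigma> = Some \<tau>" by fact
    show "\<nu> = \<sigma>" if "W \<nu> = Some \<tau>" for \<nu>
      using m that \<open>W \<sigma> = Some \<tau>\<close> unfolding acyclic_matching_def by (metis domI inj_onD)
  qed
  define f where "f \<sigma> = real_of_int (aff_dim \<sigma>) +
     (if \<sigma> \<in> dom W then h \<sigma> else if \<sigma> \<in> ran W then h (source \<sigma>) - 1 else 0)" for \<sigma>
  have nd: "\<tau> \<notin> dom W" if "W \<sigma> = Some \<tau>" for \<sigma> \<tau>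
    using m that unfolding acyclic_matching_def by (metis disjoint_iff ranI)
  have key: "f \<tau> \<le> f \<sigma> \<longleftrightarrow> W \<sigma> = Some \<tau>"
    if \<sigma>: "\<sigma> \<in> dim_simplices K p" and \<tau>: "\<tau> \<in> dim_simplices K (p + 1)" and \<sigma>\<tau>: "\<sigma> face_of \<tau>" for \<sigma> \<tau> p
  proof
    assume "W \<sigma> = Some \<tau>"
    then show "f \<tau> \<le> f \<sigma>"
      using nd[of \<sigma> \<tau>] source[of \<sigma> \<tau>] dim[OF \<sigma>] dim[OF \<tau>] ranI[of W \<sigma> \<tau>]
      by (simp add: f_def domI)
  next
    assume le: "f \<tau> \<le> f \<sigma>"
    have "f \<sigma> < real_of_int p + 1"
      using h01(2)[of \<sigma>] h01(2)[of "source \<sigma>"] dim[OF \<sigma>] by (auto simp: f_def)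
    then have \<tau>W: "\<tau> \<notin> dom W" "\<tau> \<in> ran W"
      using le h01(1)[of \<tau>] dim[OF \<tau>] by (auto simp: f_def split: if_splits)
    then have f\<tau>: "f \<tau> = p + h (source \<tau>)" using dim[OF \<tau>] by (simp add: f_def)
    \<comment> \<open>Two sources \<open>\<sigma>\<close>, \<open>\<nu>\<close> that are faces of \<open>\<tau> = W \<nu>\<close> remain; unless equal, they are ordered by \<open>h\<close>.\<close>
    obtain \<nu> where \<nu>: "W \<nu> = Some \<tau>" using \<tau>W(2) by (auto simp: ran_def)
    have \<sigma>W: "\<sigma> \<in> dom W"
    proof (rule ccontr)
      assume "\<sigma> \<notin> dom W"
      then have "f \<sigma> \<le> p" using dim[OF \<sigma>] h01(2)[of "source \<sigma>"] by (auto simp: f_def)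
      then show False using le f\<tau> h01(1)[of "source \<tau>"] by linarith
    qed
    then have "f \<sigma> = p + h \<sigma>" using dim[OF \<sigma>] by (simp add: f_def)
    then have "\<not> h \<sigma> < h \<nu>" using le f\<tau> source[OF \<nu>] by simp
    then have "(\<sigma>, \<nu>) \<notin> flow W" using h_mono by blast
    then have "\<sigma> = \<nu>" using \<sigma>W \<nu> \<sigma>\<tau> unfolding flow_def by blast
    then show "W \<sigma> = Some \<tau>" using \<nu> by simp
  qed
  have morse: "discrete_morse_function K f"
    unfolding discrete_morse_function_def
  proof (intro allI ballI conjI)
    fix p \<sigma> assume \<sigma>: "\<sigma> \<in> dim_simplices K p"
    have "{\<tau> \<in> dim_simplices K (p + 1). \<sigma> face_of \<tau> \<and> f \<tau> \<le> f \<sigma>} \<subseteq> {the (W \<sigma>)}"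
      using key[OF \<sigma>] by auto
    then show "card {\<tau> \<in> dim_simplices K (p + 1). \<sigma> face_of \<tau> \<and> f \<tau> \<le> f \<sigma>} \<le> 1"
      using card_mono[of "{the (W \<sigma>)}"] by fastforce
    have "{\<nu> \<in> dim_simplices K (p - 1). \<nu> face_of \<sigma> \<and> f \<sigma> \<le> f \<nu>} =
        {\<nu> \<in> dim_simplices K (p - 1). W \<nu> = Some \<sigma>}"
    proof (intro Collect_cong conj_cong refl)
      fix \<nu> assume "\<nu> \<in> dim_simplices K (p - 1)"
      then show "\<nu> face_of \<sigma> \<and> f \<sigma> \<le> f \<nu> \<longleftrightarrow> W \<nu> = Some \<sigma>"
        using key[of \<nu> "p - 1" \<sigma>] \<sigma> face[of \<nu> \<sigma>] by auto
    qed
    then show "card {\<nu> \<in> dim_simplices K (p - 1). \<nu> face_of \<sigma> \<and> f \<sigma> \<le> f \<nu>} \<le> 1"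
      using W \<sigma> unfolding discrete_vector_field_def by simp
  qed
  have grad: "W = gradient_field K f"
  proof
    fix \<sigma>
    let ?A = "{\<tau>. \<exists>p. \<sigma> \<in> dim_simplices K p \<and> \<tau> \<in> dim_simplices K (p + 1) \<and> \<sigma> face_of \<tau> \<and> f \<tau> \<le> f \<sigma>}"
    have A: "\<tau> \<in> ?A \<longleftrightarrow> W \<sigma> = Some \<tau>" for \<tau>
    proof
      assume "W \<sigma> = Some \<tau>"
      then have "\<sigma> \<in> K" "\<sigma> \<noteq> {}" using dom by auto
      then obtain p where p: "\<sigma> \<in> dim_simplices K p" using simplicial_complex_dim[OF K] by blast
      then show "\<tau> \<in> ?A"
        using up[OF p \<open>W \<sigma> = Some \<tau>\<close>] face[OF \<open>W \<sigma> = Some \<tau>\<close>] key[OF p] \<open>W \<sigma> = Some \<tau>\<close> by blast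
    qed (use key in blast)
    show "W \<sigma> = gradient_field K f \<sigma>"
    proof (cases "W \<sigma>")
      case None
      then have "?A = {}" using A by simp
      then show ?thesis using None by (simp add: gradient_field_def)
    next
      case (Some \<tau>)
      then have "?A = {\<tau>}" using A by auto
      then show ?thesis using Some by (simp add: gradient_field_def)
    qed
  qed
  have "self_indexing K f"
    unfolding self_indexing_def grad[symmetric] critical_points_def
    using dim by (auto simp: f_def domIff)
  then show ?thesis using morse grad by blast
qed

section \<open>Tiles of a shelled complex\<close>

lemma subset_if_rel_interior_meets:
  assumes K: "simplicial_complex K" and "\<rho> \<in> K" "\<tau> \<in> K" "rel_interior \<rho> \<inter> \<tau> \<noteq> {}"
  shows "\<rho> \<subseteq> \<tau>"
proof -
  have "\<rho> \<inter> \<tau> face_of \<rho>" using K assms by (simp add: simplicial_complex_def)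
  moreover have "\<rho> \<inter> \<tau> \<inter> rel_interior \<rho> \<noteq> {}" using assms(4) rel_interior_subset by blast
  ultimately have "\<rho> \<subseteq> \<rho> \<inter> \<tau>" using subset_of_face_of[of "\<rho> \<inter> \<tau>" \<rho> \<rho>] by blast
  then show ?thesis by blast
qed

lemma rel_interior_simplex_nonempty:
  assumes "simplicial_complex K" "\<rho> \<in> K" "\<rho> \<noteq> {}"
  shows "rel_interior \<rho> \<noteq> {}"
proof -
  have "convex \<rho>" using assms by (auto simp: simplicial_complex_def simplex_def)
  then show ?thesis using assms(3) by (simp add: rel_interior_eq_empty)
qed

text \<open>
  A smallest simplex that contains \<open>x\<close> has \<open>x\<close> in its relative interior, as its relative frontier is
  the union of its facets.
\<close>

lemma point_in_open_simplex:
  assumes K: "simplicial_complex K" and "x \<in> \<Union>K"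
  obtains \<rho> where "\<rho> \<in> K" "x \<in> rel_interior \<rho>"
proof -
  have "finite {\<rho> \<in> K. x \<in> \<rho>}" "{\<rho> \<in> K. x \<in> \<rho>} \<noteq> {}"
    using assms by (auto simp: simplicial_complex_def)
  then obtain \<rho> where \<rho>: "\<rho> \<in> K" "x \<in> \<rho>"
      and min: "\<And>\<tau>. \<tau> \<in> K \<Longrightarrow> x \<in> \<tau> \<Longrightarrow> \<tau> \<subseteq> \<rho> \<Longrightarrow> \<tau> = \<rho>"
    using finite_has_minimal[of "{\<rho> \<in> K. x \<in> \<rho>}"] by auto
  obtain C where C: "\<not> affine_dependent C" "\<rho> = convex hull C"
    using K \<rho>(1) by (auto simp: simplicial_complex_def simplex_def)
  have "x \<notin> rel_frontier \<rho>"
  proof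
    assume "x \<in> rel_frontier \<rho>"
    then obtain c where c: "c \<in> C" "x \<in> convex hull (C - {c})"
      using rel_frontier_convex_hull_cases[OF C(1)] unfolding C(2) by auto
    have "convex hull (C - {c}) face_of \<rho>"
      unfolding C(2) by (subst hull_face_of_iff[OF C(1)]) auto
    then have "convex hull (C - {c}) \<in> K" "convex hull (C - {c}) \<subseteq> \<rho>"
      using K \<rho>(1) face_of_imp_subset by (auto simp: simplicial_complex_def)
    then have "convex hull (C - {c}) = convex hull C" using min c(2) C(2) by blast
    then have "C - {c} = C" using hull_eq_iff[OF C(1), of "C - {c}" C] by blast
    then show False using c(1) by blast
  qed
  then have "x \<in> rel_interior \<rho>"
    using \<rho>(2) closure_subset by (auto simp: rel_frontier_def)
  then show thesis using that \<rho>(1) by blast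
qed

lemma subset_Union_if_rel_interior_meets:
  assumes "simplicial_complex K" "L \<subseteq> K" "\<rho> \<in> K" "rel_interior \<rho> \<inter> \<Union>L \<noteq> {}"
  shows "\<rho> \<subseteq> \<Union>L"
  using subset_if_rel_interior_meets[OF assms(1,3)] assms(2,4) by blast

text \<open>
  The vertex data of a tile are not related to \<open>K\<close> a priori. However, a difference of subcomplexes is
  a union of open simplices of \<open>K\<close>. One of these, \<open>\<rho>\<close>, contains a given interior point of the
  simplex spanned by \<open>V\<close>. On the one hand \<open>\<rho>\<close> is contained in the closure of the tile, which is
  the simplex spanned by \<open>V\<close>; on the other hand it is a face of the simplex of \<open>K\<close> around the tile
  and so contains every convex part of that simplex with an interior point in \<open>\<rho>\<close>. Hence \<open>V\<close>
  spans a simplex of \<open>K\<close>.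
\<close>

lemma open_cells_difference_tile:
  assumes K: "simplicial_complex K" and L: "L \<subseteq> K" "L' \<subseteq> K" and T: "T = \<Union>L - \<Union>L'"
    and S: "S \<in> K" "T \<subseteq> S"
    and V: "\<not> affine_dependent V" "R \<subseteq> V" "U \<subset> V" and tile: "T = morse_tile_set V R U"
  shows "open_cells K T = hull_cells V R U"
proof -
  let ?h = "convex hull V"
  have ne: "V \<noteq> {}" using V(3) by blast
  have ri: "rel_interior ?h \<subseteq> T"
    unfolding tile using rel_interior_subset_morse_tile_set_iff[OF V(1,2) _ subset_refl ne, of U] V(2,3)
    by blast
  have Th: "T \<subseteq> ?h" unfolding tile morse_tile_set_def by blast
  have "rel_interior ?h \<noteq> {}" using ne by (simp add: rel_interior_eq_empty)
  then obtain x where x: "x \<in> rel_interior ?h" by blast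
  have "x \<in> \<Union>K" using x ri L(1) unfolding T by blast
  then obtain \<rho> where \<rho>: "\<rho> \<in> K" "x \<in> rel_interior \<rho>" using point_in_open_simplex[OF K] by blast
  \<comment> \<open>\<open>\<rho>\<close> is contained in every subcomplex that meets its relative interior.\<close>
  have saturated: "rel_interior \<rho> \<subseteq> T"
  proof -
    have xT: "x \<in> \<Union>L" "x \<notin> \<Union>L'" using x ri unfolding T by blast+
    then have "\<rho> \<subseteq> \<Union>L"
      using subset_Union_if_rel_interior_meets[OF K L(1) \<rho>(1)] \<rho>(2) by blast
    moreover have "rel_interior \<rho> \<inter> \<Union>L' = {}"
      using subset_Union_if_rel_interior_meets[OF K L(2) \<rho>(1)] \<rho>(2) xT(2) rel_interior_subset by blast
    ultimately show ?thesis unfolding T using rel_interior_subset by blast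
  qed
  have simplex: "convex \<tau>" "closed \<tau>" if "\<tau> \<in> K" for \<tau>
  proof -
    obtain n where n: "n simplex \<tau>" using K \<open>\<tau> \<in> K\<close> unfolding simplicial_complex_def by blast
    show "convex \<tau>" using n by (auto simp: simplex_def)
    show "closed \<tau>" using n by (rule closed_simplex)
  qed
  have clh: "closed ?h"
    using aff_independent_finite[OF V(1)] by (simp add: finite_imp_compact_convex_hull compact_imp_closed)
  have "\<rho> \<subseteq> closure (rel_interior \<rho>)"
    using convex_closure_rel_interior[OF simplex(1)[OF \<rho>(1)]] closure_subset by blast
  also have "\<dots> \<subseteq> ?h"
    using saturated Th clh by (meson closure_minimal subset_trans)
  finally have \<rho>h: "\<rho> \<subseteq> ?h" .
  have "?h \<subseteq> closure (rel_interior ?h)"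
    using convex_closure_rel_interior[OF convex_convex_hull] closure_subset by blast
  also have "\<dots> \<subseteq> S"
    using ri S simplex(2)[OF S(1)] by (meson closure_minimal subset_trans)
  finally have hS: "?h \<subseteq> S" .
  have "x \<in> S" using x ri S(2) by blast
  then have "\<rho> \<subseteq> S"
    using subset_if_rel_interior_meets[OF K \<rho>(1) S(1)] \<rho>(2) by blast
  then have "\<rho> face_of S"
    using K S(1) \<rho>(1) unfolding simplicial_complex_def by (metis inf.absorb_iff2)
  moreover have "\<rho> \<inter> rel_interior ?h \<noteq> {}"
    using x \<rho>(2) rel_interior_subset by blast
  ultimately have "?h \<subseteq> \<rho>" using hS subset_of_face_of by blast
  then have hK: "?h \<in> K" using \<rho>h \<rho>(1) by auto
  have "open_cells K T = open_cells (faces ?h) T"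
  proof (intro equalityI subsetI)
    fix \<sigma> assume "\<sigma> \<in> open_cells K T"
    then have \<sigma>: "\<sigma> \<in> K" "\<sigma> \<noteq> {}" "rel_interior \<sigma> \<subseteq> T" by (auto simp: open_cells_def)
    have "rel_interior \<sigma> \<inter> ?h \<noteq> {}"
      using rel_interior_simplex_nonempty[OF K \<sigma>(1,2)] \<sigma>(3) Th by blast
    then have "\<sigma> \<subseteq> ?h" using subset_if_rel_interior_meets[OF K \<sigma>(1) hK] by blast
    then have "\<sigma> face_of ?h"
      using K \<sigma>(1) hK unfolding simplicial_complex_def by (metis inf.absorb_iff2)
    then show "\<sigma> \<in> open_cells (faces ?h) T" using \<sigma> by (simp add: open_cells_def faces_def)
  next
    fix \<sigma> assume "\<sigma> \<in> open_cells (faces ?h) T"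
    then show "\<sigma> \<in> open_cells K T"
      using K hK by (auto simp: open_cells_def faces_def simplicial_complex_def)
  qed
  then show ?thesis
    using V open_cells_morse_tile_set[OF V(1,2), of U] unfolding tile by auto
qed

text \<open>
  The cells are the faces that contain \<open>R\<close>, except the one spanned by \<open>R\<close>: they are \<open>2 ^ m - 1\<close> in
  number with \<open>m > 0\<close>. The second assumption expresses that \<open>C\<close> is the set of cells of \<open>T\<close> for any vertex data of \<open>T\<close>.
\<close>

lemma critical_tile_odd_card:
  assumes "critical_tile k T" and tile: "\<And>V R U. \<not> affine_dependent V \<Longrightarrow> R \<subseteq> V \<Longrightarrow> U \<subset> V \<Longrightarrow>
      T = morse_tile_set V R U \<Longrightarrow> C = hull_cells V R U"
  shows "odd (card C)"
proof -
  obtain V R where V: "\<not> affine_dependent V" and R: "R \<subset> V" and T: "T = morse_tile_set V R R"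
    using assms(1) by (rule critical_tileE)
  have "V - R \<noteq> {}" "finite (V - R)"
    using R aff_independent_finite[OF V] by auto
  then have "card (V - R) \<noteq> 0" by simp
  moreover have "C = hull_cells V R R" using tile[OF V _ R T] R by blast
  ultimately show ?thesis
    using card_hull_cells[OF V, of R R] R by (simp add: psubset_eq)
qed

text \<open>
  In a Morse shelling, every tile is the difference of two consecutive subcomplexes.
\<close>

locale shelled_complex =
  fixes K :: "'a::euclidean_space set set" and TT N F
  assumes complex: "simplicial_complex K" and shelling: "morse_shelling K TT N F"
begin

abbreviation tile :: "nat \<Rightarrow> 'a set" where
  "tile i \<equiv> F i - F (i - 1)"

definition stage :: "'a set \<Rightarrow> nat" where
  "stage \<sigma> = (LEAST i. \<sigma> \<subseteq> F i)"

lemma F_0: "F 0 = {}" and F_N: "F N = \<Union>K"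
  using shelling by (auto simp: morse_shelling_def)

lemma F_subcomplex:
  assumes "i \<le> N"
  obtains L where "L \<subseteq> K" "F i = \<Union>L"
proof -
  have "subcomplex_space K (F i)" using shelling assms by (simp add: morse_shelling_def)
  then show thesis using that unfolding subcomplex_space_def by blast
qed

lemma tile_in: "1 \<le> i \<Longrightarrow> i \<le> N \<Longrightarrow> tile i \<in> TT"
  using shelling by (auto simp: morse_shelling_def)

lemma F_mono: "i \<le> j \<Longrightarrow> j \<le> N \<Longrightarrow> F i \<subseteq> F j"
proof (induction rule: dec_induct)
  case (step n)
  moreover have "F (Suc n - 1) \<subseteq> F (Suc n)"
  proof -
    have "\<forall>i\<in>{1..N}. F (i - 1) \<subseteq> F i" using shelling by (simp add: morse_shelling_def)
    then show ?thesis using step.prems by (elim ballE[of _ _ "Suc n"]) auto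
  qed
  ultimately show ?case by simp
qed simp

lemma partition: "partition_on (\<Union>K) TT"
  using shelling by (simp add: morse_shelling_def morse_tiling_def)

lemma tile_exhaust:
  assumes "T \<in> TT"
  obtains i where "1 \<le> i" "i \<le> N" "T = tile i"
proof -
  have "T \<noteq> {}" "T \<subseteq> \<Union>K"
    using partition assms by (auto simp: partition_on_def)
  then obtain x where x: "x \<in> T" "x \<in> F N" using F_N by blast
  define i where "i = (LEAST i. x \<in> F i)"
  have i: "x \<in> F i" "i \<le> N"
    unfolding i_def using x(2) by (auto intro: LeastI Least_le)
  then have "1 \<le> i" using F_0 by (cases i) auto
  then have "x \<notin> F (i - 1)"
    using not_less_Least[of "i - 1" "\<lambda>i. x \<in> F i"] unfolding i_def by simp
  then have "x \<in> T \<inter> tile i" using x(1) i(1) by blast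
  moreover have "disjoint TT" using partition by (simp add: partition_on_def)
  ultimately have "T = tile i"
    using disjointD[OF _ assms tile_in[OF \<open>1 \<le> i\<close> i(2)]] by blast
  then show thesis using that \<open>1 \<le> i\<close> i(2) by blast
qed

lemma stage:
  assumes "\<sigma> \<in> K" "\<sigma> \<noteq> {}"
  shows "\<sigma> \<subseteq> F (stage \<sigma>)" "1 \<le> stage \<sigma>" "stage \<sigma> \<le> N"
proof -
  have N: "\<sigma> \<subseteq> F N" using assms F_N by blast
  show s: "\<sigma> \<subseteq> F (stage \<sigma>)" unfolding stage_def by (rule LeastI[of _ N]) (rule N)
  show "stage \<sigma> \<le> N" unfolding stage_def by (rule Least_le) (rule N)
  show "1 \<le> stage \<sigma>" using s F_0 assms(2) by (cases "stage \<sigma>") auto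
qed

lemma stage_mono:
  assumes "\<tau> \<in> K" "\<sigma> \<noteq> {}" "\<sigma> \<subseteq> \<tau>"
  shows "stage \<sigma> \<le> stage \<tau>"
proof -
  have "\<tau> \<noteq> {}" using assms by blast
  then have "\<sigma> \<subseteq> F (stage \<tau>)" using stage(1) assms by blast
  then show ?thesis unfolding stage_def[of \<sigma>] by (rule Least_le)
qed

text \<open>
  Being contained in \<open>F j\<close> is equivalent to having an interior point in \<open>F j\<close>, for simplices of \<open>K\<close>.
\<close>

lemma open_cells_tile:
  assumes i: "1 \<le> i" "i \<le> N"
  shows "open_cells K (tile i) = {\<sigma> \<in> K - {{}}. stage \<sigma> = i}"
proof -
  have "rel_interior \<sigma> \<subseteq> tile i \<longleftrightarrow> stage \<sigma> = i" if \<sigma>: "\<sigma> \<in> K" "\<sigma> \<noteq> {}" for \<sigma>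
  proof -
    have sub: "\<sigma> \<subseteq> F j \<longleftrightarrow> rel_interior \<sigma> \<inter> F j \<noteq> {}" if j: "j \<le> N" for j
    proof
      assume "\<sigma> \<subseteq> F j"
      then show "rel_interior \<sigma> \<inter> F j \<noteq> {}"
        using rel_interior_simplex_nonempty[OF complex \<sigma>] rel_interior_subset[of \<sigma>] by blast
    next
      assume m: "rel_interior \<sigma> \<inter> F j \<noteq> {}"
      obtain L where "L \<subseteq> K" "F j = \<Union>L" using F_subcomplex[OF j] .
      then show "\<sigma> \<subseteq> F j" using subset_Union_if_rel_interior_meets[OF complex _ \<sigma>(1)] m by simp
    qed
    have ne: "rel_interior \<sigma> \<noteq> {}" using rel_interior_simplex_nonempty[OF complex \<sigma>] .
    have "rel_interior \<sigma> \<subseteq> tile i \<longleftrightarrow> \<sigma> \<subseteq> F i \<and> \<not> \<sigma> \<subseteq> F (i - 1)"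
      using sub[OF i(2)] sub[of "i - 1"] i(2) ne rel_interior_subset[of \<sigma>] by auto
    also have "\<dots> \<longleftrightarrow> stage \<sigma> = i"
    proof
      assume a: "\<sigma> \<subseteq> F i \<and> \<not> \<sigma> \<subseteq> F (i - 1)"
      then have "stage \<sigma> \<le> i" unfolding stage_def by (intro Least_le) blast
      moreover have "\<not> stage \<sigma> \<le> i - 1"
      proof
        assume "stage \<sigma> \<le> i - 1"
        then have "F (stage \<sigma>) \<subseteq> F (i - 1)" using i(2) by (intro F_mono) auto
        then show False using a stage(1)[OF \<sigma>] by blast
      qed
      ultimately show "stage \<sigma> = i" by simp
    next
      assume s: "stage \<sigma> = i"
      then have "\<not> \<sigma> \<subseteq> F (i - 1)"
        using not_less_Least[of "i - 1" "\<lambda>i. \<sigma> \<subseteq> F i"] i unfolding stage_def by simp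
      then show "\<sigma> \<subseteq> F i \<and> \<not> \<sigma> \<subseteq> F (i - 1)" using stage(1)[OF \<sigma>] s by blast
    qed
    finally show ?thesis .
  qed
  then show ?thesis unfolding open_cells_def by blast
qed

lemma open_cells_tile_hull_cells:
  assumes i: "1 \<le> i" "i \<le> N"
    and V: "\<not> affine_dependent V" "R \<subseteq> V" "U \<subset> V" "tile i = morse_tile_set V R U"
  shows "open_cells K (tile i) = hull_cells V R U"
proof -
  obtain L where L: "L \<subseteq> K" "F i = \<Union>L" using F_subcomplex[OF i(2)] .
  obtain L' where L': "L' \<subseteq> K" "F (i - 1) = \<Union>L'"
    using F_subcomplex[OF le_trans[OF diff_le_self i(2)]] .
  have "\<forall>T\<in>TT. \<exists>\<sigma>\<in>K. T \<subseteq> \<sigma>"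
    using shelling by (simp add: morse_shelling_def morse_tiling_def)
  then obtain S where S: "S \<in> K" "tile i \<subseteq> S" using tile_in[OF i] by blast
  have "tile i = \<Union>L - \<Union>L'" using L L' by simp
  then show ?thesis
    by (rule open_cells_difference_tile[OF complex L(1) L'(1) _ S V])
qed

section \<open>Compatible fields on a shelled complex\<close>

context
  fixes W
  assumes dvf: "discrete_vector_field K W" and compat: "compatible_field K TT W"
begin

abbreviation "layer i \<equiv> {\<sigma> \<in> K - {{}}. stage \<sigma> = i}"

lemma layer_field:
  assumes i: "1 \<le> i" "i \<le> N"
  shows "acyclic_matching (layer i) (W |` layer i)"
    and "(\<nexists>k. critical_tile k (tile i)) \<and> unmatched (layer i) (W |` layer i) = {} \<or>
      (\<exists>\<sigma> k. unmatched (layer i) (W |` layer i) = {\<sigma>} \<and> int k simplex \<sigma> \<and> critical_tile k (tile i))"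
proof -
  have "field_on_basic_tile (tile i) (W |` layer i) \<or> field_on_critical_tile (tile i) (W |` layer i) \<or>
      field_on_regular_tile (tile i) (W |` layer i)"
    using compat tile_in[OF i] unfolding compatible_field_def Let_def open_cells_tile[OF i, symmetric]
    by blast
  then obtain V R U where V: "\<not> affine_dependent V" "R \<subseteq> V" "U \<subset> V" "tile i = morse_tile_set V R U"
    and m: "acyclic_matching (hull_cells V R U) (W |` layer i)"
    and crit: "even (card (hull_cells V R U)) \<and> unmatched (hull_cells V R U) (W |` layer i) = {} \<or>
     (\<exists>\<sigma> k. unmatched (hull_cells V R U) (W |` layer i) = {\<sigma>} \<and> int k simplex \<sigma> \<and>
        critical_tile k (tile i))"
    by (rule field_on_tile_matching)
  have eq: "hull_cells V R U = layer i"
    using open_cells_tile_hull_cells[OF i V] open_cells_tile[OF i] by simp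
  show "acyclic_matching (layer i) (W |` layer i)" using m unfolding eq .
  have "\<not> critical_tile k (tile i)" if "even (card (layer i))" for k
    using critical_tile_odd_card[of k "tile i" "layer i"] that open_cells_tile_hull_cells[OF i]
    unfolding open_cells_tile[OF i] by blast
  then show "(\<nexists>k. critical_tile k (tile i)) \<and> unmatched (layer i) (W |` layer i) = {} \<or>
      (\<exists>\<sigma> k. unmatched (layer i) (W |` layer i) = {\<sigma>} \<and> int k simplex \<sigma> \<and> critical_tile k (tile i))"
    using crit unfolding eq by blast
qed

lemma no_layer:
  assumes "\<not> (1 \<le> i \<and> i \<le> N)"
  shows "layer i = {}"
  using stage(2,3) assms by blast

text \<open>
  The gluing principle along the shelling. Compatibility with the tiling gives the matchings on the
  levels, and the filtration by subcomplexes makes the index of the tile monotone along faces.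
\<close>

lemma
  shows acyclic_matching_field: "acyclic_matching (K - {{}}) W"
    and unmatched_field: "unmatched (K - {{}}) W = (\<Union>i. unmatched (layer i) (W |` layer i))"
proof -
  have dom: "dom W \<subseteq> K - {{}}" using dvf by (simp add: discrete_vector_field_def)
  have layers: "acyclic_matching (layer i) (W |` layer i)" for i
  proof (cases "1 \<le> i \<and> i \<le> N")
    case False
    show ?thesis unfolding no_layer[OF False] by (simp add: acyclic_matching_empty)
  qed (use layer_field in blast)
  have mono: "stage \<sigma> \<le> stage \<tau>" if "\<sigma> \<in> K - {{}}" "\<tau> \<in> K - {{}}" "\<sigma> face_of \<tau>" for \<sigma> \<tau>
    using that by (intro stage_mono face_of_imp_subset) auto
  show "acyclic_matching (K - {{}}) W"
    by (rule acyclic_matching_glue[OF dom layers mono])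
  show "unmatched (K - {{}}) W = (\<Union>i. unmatched (layer i) (W |` layer i))"
    by (rule unmatched_glue[OF dom layers mono])
qed

text \<open>
  A critical point is sent to the tile that contains its open simplex.
\<close>

lemma critical_points_bij_critical_tiles:
  "\<exists>\<phi>. bij_betw \<phi> (critical_points K W) {T \<in> TT. \<exists>k. critical_tile k T} \<and>
    (\<forall>\<sigma> \<in> critical_points K W. \<forall>p::nat. int p simplex \<sigma> \<longrightarrow> critical_tile p (\<phi> \<sigma>))"
proof -
  let ?\<phi> = "\<lambda>\<sigma>. tile (stage \<sigma>)"
  let ?u = "\<lambda>i. unmatched (layer i) (W |` layer i)"
  have crit: "critical_points K W = (\<Union>i. ?u i)"
    unfolding unmatched_field[symmetric] by (auto simp: critical_points_def unmatched_def domIff)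
  have stage_u: "stage \<sigma> = i" "1 \<le> i" "i \<le> N" if "\<sigma> \<in> ?u i" for \<sigma> i
    using that stage[of \<sigma>] by (auto simp: unmatched_def)
  have index: "?u (stage \<sigma>) = {\<sigma>} \<and> (\<exists>k. int k simplex \<sigma> \<and> critical_tile k (?\<phi> \<sigma>)) \<and> ?\<phi> \<sigma> \<in> TT"
    if "\<sigma> \<in> critical_points K W" for \<sigma>
  proof -
    obtain i where i: "\<sigma> \<in> ?u i" using \<open>\<sigma> \<in> critical_points K W\<close> unfolding crit by blast
    note s = stage_u[OF i]
    obtain \<rho> k where "?u i = {\<rho>}" "int k simplex \<rho>" "critical_tile k (tile i)"
      using layer_field(2)[OF s(2,3)] i by blast
    then show ?thesis using i s(1) tile_in[OF s(2,3)] by auto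
  qed
  have "inj_on ?\<phi> (critical_points K W)"
  proof (rule inj_onI)
    fix \<sigma> \<rho> assume a: "\<sigma> \<in> critical_points K W" "\<rho> \<in> critical_points K W" "?\<phi> \<sigma> = ?\<phi> \<rho>"
    have "1 \<le> stage \<sigma>" "stage \<sigma> \<le> N" "1 \<le> stage \<rho>" "stage \<rho> \<le> N"
      using stage a(1,2) by (auto simp: critical_points_def)
    then have "layer (stage \<sigma>) = layer (stage \<rho>)"
      using open_cells_tile[of "stage \<sigma>"] open_cells_tile[of "stage \<rho>"] a(3) by simp
    then have "?u (stage \<sigma>) = ?u (stage \<rho>)" by simp
    then show "\<sigma> = \<rho>" using index[OF a(1)] index[OF a(2)] by simp
  qed
  moreover have "?\<phi> ` critical_points K W = {T \<in> TT. \<exists>k. critical_tile k T}"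
  proof (intro equalityI subsetI)
    fix T assume "T \<in> {T \<in> TT. \<exists>k. critical_tile k T}"
    then obtain k where T: "T \<in> TT" "critical_tile k T" by blast
    obtain i where i: "1 \<le> i" "i \<le> N" "T = tile i" using T(1) by (rule tile_exhaust)
    then obtain \<sigma> where "?u i = {\<sigma>}" using layer_field(2)[OF i(1,2)] T(2) by blast
    then have \<sigma>: "\<sigma> \<in> ?u i" by blast
    then have "\<sigma> \<in> critical_points K W" unfolding crit by blast
    moreover have "T = ?\<phi> \<sigma>" using stage_u(1)[OF \<sigma>] i(3) by simp
    ultimately show "T \<in> ?\<phi> ` critical_points K W" by blast
  qed (use index in blast)
  moreover have "critical_tile p (?\<phi> \<sigma>)" if \<sigma>: "\<sigma> \<in> critical_points K W" "int p simplex \<sigma>" for \<sigma> p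
  proof -
    obtain k where k: "int k simplex \<sigma>" "critical_tile k (?\<phi> \<sigma>)" using index[OF \<sigma>(1)] by blast
    then have "k = p" using aff_dim_simplex[OF k(1)] aff_dim_simplex[OF \<sigma>(2)] by simp
    then show ?thesis using k(2) by simp
  qed
  ultimately show ?thesis unfolding bij_betw_def by (intro exI[of _ ?\<phi>]) blast
qed

end

end

theorem theorem1p2:
  fixes K :: "'a::euclidean_space set set"
    and TT :: "'a set set"
    and N :: nat
    and F :: "nat \<Rightarrow> 'a set"
    and W :: "'a set \<Rightarrow> 'a set option"
  assumes "simplicial_complex K"
    and "morse_shelling K TT N F"
    and "discrete_vector_field K W"
    and "compatible_field K TT W"
  shows "\<exists>f. discrete_morse_function K f \<and> self_indexing K f \<and> W = gradient_field K f \<and>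
           (\<exists>\<phi>. bij_betw \<phi> (critical_points K (gradient_field K f)) {T \<in> TT. \<exists>k. critical_tile k T} \<and>
                (\<forall>\<sigma> \<in> critical_points K (gradient_field K f).
                   \<forall>p::nat. int p simplex \<sigma> \<longrightarrow> critical_tile p (\<phi> \<sigma>)))"
proof -
  interpret shelled_complex K TT N F
    using assms(1,2) by unfold_locales
  obtain f where "discrete_morse_function K f" "self_indexing K f" "W = gradient_field K f"
    using acyclic_field_is_gradient[OF assms(1,3) acyclic_matching_field[OF assms(3,4)]] by blast
  then show ?thesis
    using critical_points_bij_critical_tiles[OF assms(3,4)] by (intro exI[of _ f]) simp
qed

end
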